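(* Let $f:\mathbb{R}\times\mathbb{R}^m\to\mathbb{R}$ be convex with at most quadratic growth, let $g:\mathbb{R}^n\to\mathbb{R}$ be convex and Lipschitz continuous, and let $\rho:L^2(\Omega)\to\mathbb{R}$ be the extremal risk measure $\rho(\xi)=\inf_{y\in\mathbb{R}^m}\mathbb{E}[f(\xi,y)]$. Then $$\inf_{A\in\mathcal{A}}\rho\left(g(X^A_T)\right)=\inf_{y\in\mathbb{R}^m}V(y),\qquad\text{where}\qquad V(y):=\inf_{A\in\mathcal{A}}\mathbb{E}\left[f(g(X^A_T),y)\right].$$
   Context: Setting. Fix $T>0$. $(\Omega,\mathcal{F},\mathbb{P})$ is a probability space supporting a standard $d$-dimensional Brownian motion $W$ with filtration $\{\mathcal{F}_t\}_{0\le t\le T}$ satisfying the usual conditions. $\mathbb{A}$ is a compact subset of a finite-dimensional Euclidean space; $\mathcal{A}$ is the set of all $\mathcal{F}_t$-progressively measurable processes valued in $\mathbb{A}$ almost surely. The functions $\mu:\mathbb{R}^n\times\mathbb{A}\to\mathbb{R}^n$ and $\sigma:\mathbb{R}^n\times\mathbb{A}\to\mathbb{R}^{n\times d}$ are continuous and for some $K>0$ satisfy $\|\mu(x,a)-\mu(x',a)\|+\|\sigma(x,a)-\sigma(x',a)\|\le K\|x-x'\|$ and $\|\mu(x,a)\|+\|\sigma(x,a)\|\le K(1+\|x\|+\|a\|)$ for all $x,x'\in\mathbb{R}^n$, $a\in\mathbb{A}$. For $A\in\mathcal{A}$, $X^A$ is the unique strong solution of $dX^A_t=\mu(X^A_t,A_t)\,dt+\sigma(X^A_t,A_t)\,dW_t$,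 $X^A_0=\bm{x}_0$, with $\bm{x}_0\in\mathbb{R}^n$ fixed. An extremal risk measure is a function $\rho:L^2(\Omega)\to\mathbb{R}$ for which there is a convex $f:\mathbb{R}\times\mathbb{R}^m\to\mathbb{R}$ with $\rho(\xi)=\inf_{y\in\mathbb{R}^m}\mathbb{E}[f(\xi,y)]$. *)

theory Defs
  imports "HOL-Probability.Probability"
begin

section \<open>Filtrations and processes on a finite horizon\<close>

text \<open>A process is a function of time and outcome. Time has type \<^typ>\<open>real\<close>, but everything
  below only depends on the restriction to the interval from 0 to T. Of the measures \<open>F t\<close> only
  the sigma-algebras matter.\<close>

definition usual_filtration :: "'a measure \<Rightarrow> real \<Rightarrow> (real \<Rightarrow> 'a measure) \<Rightarrow> bool" where
  "usual_filtration M T F \<longleftrightarrow>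
     (\<forall>t\<in>{0..T}. subalgebra M (F t)) \<and>
     (\<forall>s t. 0 \<le> s \<and> s \<le> t \<and> t \<le> T \<longrightarrow> sets (F s) \<subseteq> sets (F t)) \<and>
     (\<forall>t\<in>{0..<T}. sets (F t) = (\<Inter>s\<in>{t<..T}. sets (F s))) \<and>
     complete_measure M \<and> null_sets M \<subseteq> sets (F 0)"

definition adapted ::
  "real \<Rightarrow> (real \<Rightarrow> 'a measure) \<Rightarrow> (real \<Rightarrow> 'a \<Rightarrow> 'b::topological_space) \<Rightarrow> bool" where
  "adapted T F X \<longleftrightarrow> (\<forall>t\<in>{0..T}. X t \<in> borel_measurable (F t))"

definition continuous_paths ::
  "'a measure \<Rightarrow> real \<Rightarrow> (real \<Rightarrow> 'a \<Rightarrow> 'b::topological_space) \<Rightarrow> bool" where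
  "continuous_paths M T X \<longleftrightarrow> (AE \<omega> in M. continuous_on {0..T} (\<lambda>t. X t \<omega>))"

definition progressively_measurable ::
  "real \<Rightarrow> (real \<Rightarrow> 'a measure) \<Rightarrow> (real \<Rightarrow> 'a \<Rightarrow> 'b::topological_space) \<Rightarrow> bool" where
  "progressively_measurable T F X \<longleftrightarrow>
     (\<forall>t\<in>{0..T}. (\<lambda>(s, \<omega>). X s \<omega>) \<in> borel_measurable (restrict_space borel {0..t} \<Otimes>\<^sub>M F t))"

definition admissible_controls ::
  "'a measure \<Rightarrow> real \<Rightarrow> (real \<Rightarrow> 'a measure) \<Rightarrow> 'k::euclidean_space set \<Rightarrow> (real \<Rightarrow> 'a \<Rightarrow> 'k) set"
  where
  "admissible_controls M T F \<AA> =
     {A. progressively_measurable T F A \<and> (AE \<omega> in M. \<forall>t\<in>{0..T}. A t \<omega> \<in> \<AA>)}"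

section \<open>Brownian motion\<close>

definition brownian_motion ::
  "'a measure \<Rightarrow> real \<Rightarrow> (real \<Rightarrow> 'a measure) \<Rightarrow> (real \<Rightarrow> 'a \<Rightarrow> real ^ 'd) \<Rightarrow> bool" where
  "brownian_motion M T F W \<longleftrightarrow>
     adapted T F W \<and> continuous_paths M T W \<and> (AE \<omega> in M. W 0 \<omega> = 0) \<and>
     (\<forall>s t. 0 \<le> s \<and> s < t \<and> t \<le> T \<longrightarrow>
        prob_space.indep_set M (sets (F s))
          {(\<lambda>\<omega>. W t \<omega> - W s \<omega>) -` B \<inter> space M |B. B \<in> sets borel} \<and>
        prob_space.indep_vars M (\<lambda>_. borel) (\<lambda>i \<omega>. (W t \<omega> - W s \<omega>) $ i) UNIV \<and>
        (\<forall>i. distributed M lborel (\<lambda>\<omega>. (W t \<omega> - W s \<omega>) $ i) (normal_density 0 (sqrt (t - s)))))"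

section \<open>The Ito integral\<close>

definition tends_to_0_in_probability :: "'a measure \<Rightarrow> (nat \<Rightarrow> 'a \<Rightarrow> ennreal) \<Rightarrow> bool" where
  "tends_to_0_in_probability M Z \<longleftrightarrow>
     (\<forall>j. Z j \<in> borel_measurable M) \<and>
     (\<forall>\<epsilon>>0. (\<lambda>j. measure M {\<omega> \<in> space M. Z j \<omega> > ennreal \<epsilon>}) \<longlonglongrightarrow> 0)"

text \<open>The measurability requirement above is there because
  \<^const>\<open>measure\<close> is 0 on sets that are not measurable.

  A simple integrand takes the value \<open>H i\<close> on the interval from \<open>p i\<close> (exclusive) to \<open>p (Suc i)\<close>
  (inclusive), for \<open>i < k\<close>.\<close>

definition simple_integrand ::
  "'a measure \<Rightarrow> real \<Rightarrow> (real \<Rightarrow> 'a measure) \<Rightarrow> nat \<Rightarrow> (nat \<Rightarrow> real) \<Rightarrow>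
   (nat \<Rightarrow> 'a \<Rightarrow> real ^ 'd ^ 'n) \<Rightarrow> bool" where
  "simple_integrand M T F k p H \<longleftrightarrow>
     p 0 = 0 \<and> p k = T \<and> (\<forall>i<k. p i < p (Suc i)) \<and>
     (\<forall>i<k. H i \<in> borel_measurable (F (p i))) \<and>
     (\<exists>C. \<forall>i<k. \<forall>\<omega>\<in>space M. norm (H i \<omega>) \<le> C)"

definition simple_process ::
  "nat \<Rightarrow> (nat \<Rightarrow> real) \<Rightarrow> (nat \<Rightarrow> 'a \<Rightarrow> real ^ 'd ^ 'n) \<Rightarrow> real \<Rightarrow> 'a \<Rightarrow> real ^ 'd ^ 'n" where
  "simple_process k p H s \<omega> = (\<Sum>i<k. indicator {p i<..p (Suc i)} s *\<^sub>R H i \<omega>)"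

definition simple_integral ::
  "(real \<Rightarrow> 'a \<Rightarrow> real ^ 'd) \<Rightarrow> nat \<Rightarrow> (nat \<Rightarrow> real) \<Rightarrow> (nat \<Rightarrow> 'a \<Rightarrow> real ^ 'd ^ 'n) \<Rightarrow>
   real \<Rightarrow> 'a \<Rightarrow> real ^ 'n" where
  "simple_integral W k p H t \<omega> =
     (\<Sum>i<k. H i \<omega> *v (W (min t (p (Suc i))) \<omega> - W (min t (p i)) \<omega>))"

text \<open>\<open>I\<close> is the (continuous version of the) Ito integral process of \<open>\<Phi>\<close>, for integrands that are
  almost surely square integrable in time: the limit in probability of integrals of simple
  integrands converging to \<open>\<Phi>\<close> in probability in the space of square integrable functions of time.
  The norm on matrices is the Frobenius norm.\<close>

definition ito_integral ::
  "'a measure \<Rightarrow> real \<Rightarrow> (real \<Rightarrow> 'a measure) \<Rightarrow> (real \<Rightarrow> 'a \<Rightarrow> real ^ 'd) \<Rightarrow>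
   (real \<Rightarrow> 'a \<Rightarrow> real ^ 'd ^ 'n) \<Rightarrow> (real \<Rightarrow> 'a \<Rightarrow> real ^ 'n) \<Rightarrow> bool" where
  "ito_integral M T F W \<Phi> I \<longleftrightarrow>
     adapted T F I \<and> continuous_paths M T I \<and>
     (AE \<omega> in M. set_integrable lborel {0..T} (\<lambda>s. (norm (\<Phi> s \<omega>))\<^sup>2)) \<and>
     (\<exists>k p H. (\<forall>j. simple_integrand M T F (k j) (p j) (H j)) \<and>
        tends_to_0_in_probability M
          (\<lambda>j \<omega>. \<integral>\<^sup>+s\<in>{0..T}.
             ennreal ((norm (simple_process (k j) (p j) (H j) s \<omega> - \<Phi> s \<omega>))\<^sup>2) \<partial>lborel) \<and>
        (\<forall>t\<in>{0..T}. tends_to_0_in_probability M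
          (\<lambda>j \<omega>. ennreal (norm (simple_integral W (k j) (p j) (H j) t \<omega> - I t \<omega>)))))"

section \<open>Controlled diffusions\<close>

text \<open>\<open>strong_solution M T F W \<mu> \<sigma> x0 A X\<close>: the process \<open>X\<close> satisfies, up to time \<open>T\<close>,
  \<open>dX = \<mu>(X, A) dt + \<sigma>(X, A) dW\<close> and \<open>X 0 = x0\<close>. No moment bound on \<open>X\<close> is required.\<close>

definition strong_solution ::
  "'a measure \<Rightarrow> real \<Rightarrow> (real \<Rightarrow> 'a measure) \<Rightarrow> (real \<Rightarrow> 'a \<Rightarrow> real ^ 'd) \<Rightarrow>
   (real ^ 'n \<Rightarrow> 'k \<Rightarrow> real ^ 'n) \<Rightarrow> (real ^ 'n \<Rightarrow> 'k \<Rightarrow> real ^ 'd ^ 'n) \<Rightarrow> real ^ 'n \<Rightarrow>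
   (real \<Rightarrow> 'a \<Rightarrow> 'k) \<Rightarrow> (real \<Rightarrow> 'a \<Rightarrow> real ^ 'n) \<Rightarrow> bool" where
  "strong_solution M T F W \<mu> \<sigma> x0 A X \<longleftrightarrow>
     adapted T F X \<and> continuous_paths M T X \<and>
     (AE \<omega> in M. set_integrable lborel {0..T} (\<lambda>s. \<mu> (X s \<omega>) (A s \<omega>))) \<and>
     (\<exists>I. ito_integral M T F W (\<lambda>s \<omega>. \<sigma> (X s \<omega>) (A s \<omega>)) I \<and>
        (AE \<omega> in M. \<forall>t\<in>{0..T}.
           X t \<omega> = x0 + (LINT s:{0..t}|lborel. \<mu> (X s \<omega>) (A s \<omega>)) + I t \<omega>))"

section \<open>Extremal risk measures\<close>

definition square_integrable :: "'a measure \<Rightarrow> ('a \<Rightarrow> real) set" where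
  "square_integrable M = {\<xi>. \<xi> \<in> borel_measurable M \<and> integrable M (\<lambda>\<omega>. (\<xi> \<omega>)\<^sup>2)}"

text \<open>The infimum is taken in the extended reals, so that the equation includes its finiteness.
  Random variables are not identified up to null sets; the equation forces \<open>\<rho>\<close> to respect this
  identification. Its values at functions that are not square integrable are left arbitrary.\<close>

definition extremal_risk_measure ::
  "'a measure \<Rightarrow> (real \<times> (real ^ 'm) \<Rightarrow> real) \<Rightarrow> (('a \<Rightarrow> real) \<Rightarrow> real) \<Rightarrow> bool" where
  "extremal_risk_measure M f \<rho> \<longleftrightarrow>
     convex_on UNIV f \<and>
     (\<forall>\<xi>\<in>square_integrable M. ereal (\<rho> \<xi>) = (INF y. ereal (\<integral>\<omega>. f (\<xi> \<omega>, y) \<partial>M)))"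

definition at_most_quadratic_growth :: "('b::real_normed_vector \<Rightarrow> real) \<Rightarrow> bool" where
  "at_most_quadratic_growth f \<longleftrightarrow> (\<exists>C. \<forall>z. \<bar>f z\<bar> \<le> C * (1 + (norm z)\<^sup>2))"

end

theory Submission
  imports Defs
begin

text \<open>Once each \<open>g (X A T)\<close> is known to be square integrable, both sides are iterated infima taken
  in a different order. The solutions come without any moment bound, so the substance is
  \<open>E |X T|\<^sup>2 < \<infinity>\<close>.

  Let \<open>R t\<close> be the integral of \<open>\<kappa> (1 + |X s|\<^sup>2)\<close> over \<open>s \<le> t\<close>, which dominates the integrals of
  \<open>|\<mu>|\<^sup>2\<close> and \<open>|\<sigma>|\<^sup>2\<close> along the path. Stopping times are avoided: instead of stopping \<open>X\<close>, one
  bounds \<open>w t = E (|X t|\<^sup>2; R t \<le> c)\<close>. Truncating the approximating simple integrands when their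
  accumulated square exceeds \<open>2 c + 1\<close> and using the isometry for simple integrands together with
  Fatou's lemma yields \<open>E (|I t|\<^sup>2; R t \<le> c) \<le> 1 + 2 E (min c (R t))\<close> for the Ito integral \<open>I\<close>.
  Since \<open>min c (R t)\<close> is at most the integral of \<open>\<kappa> (1 + |X s|\<^sup>2)\<close> over those \<open>s \<le> t\<close> with \<open>R s \<le> c\<close>,
  the bounded function \<open>w\<close> satisfies a Gronwall inequality whose constants do not depend on \<open>c\<close>,
  and \<open>c\<close> may tend to infinity.\<close>

section \<open>The isometry for simple integrands\<close>

text \<open>\<open>Y\<close> and \<open>\<phi> (Z \<omega>)\<close> generate sigma-algebras inside
  \<open>G\<close> and inside the one generated by \<open>Z\<close>, so they inherit independence
  and the expectation factors. In use, \<open>Y\<close> is known at the left endpoint of a time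
  step, \<open>Z\<close> is the Brownian increment over it and \<open>\<phi>\<close> is a monomial
  of degree one or two.\<close>

lemma (in prob_space) has_bochner_integral_mult_indep_subalgebra:
  fixes Y :: "'a \<Rightarrow> real" and Z :: "'a \<Rightarrow> 'b::topological_space" and \<phi> :: "'b \<Rightarrow> real"
  assumes G: "subalgebra M G"
    and ind: "indep_set (sets G) {Z -` B \<inter> space M |B. B \<in> sets borel}"
    and Y: "Y \<in> borel_measurable G" and Z: "Z \<in> borel_measurable M"
    and \<phi>: "\<phi> \<in> borel_measurable borel"
    and Y': "integrable M Y" and Z': "has_bochner_integral M (\<lambda>\<omega>. \<phi> (Z \<omega>)) z"
  shows "has_bochner_integral M (\<lambda>\<omega>. Y \<omega> * \<phi> (Z \<omega>)) (expectation Y * z)"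
proof -
  have spG: "space G = space M" using G by (simp add: subalgebra_def)
  have YM: "Y \<in> borel_measurable M" using measurable_from_subalg[OF G Y] .
  have sub1: "{Y -` A \<inter> space M |A. A \<in> sets borel} \<subseteq> sets G"
    using measurable_sets[OF Y] by (auto simp: spG)
  have sub2: "{(\<lambda>\<omega>. \<phi> (Z \<omega>)) -` A \<inter> space M |A. A \<in> sets borel} \<subseteq> {Z -` B \<inter> space M |B. B \<in> sets borel}"
  proof safe
    fix A :: "real set" assume A: "A \<in> sets borel"
    have "\<phi> -` A \<in> sets borel" using measurable_sets[OF \<phi> A] by simp
    then show "\<exists>B. (\<lambda>\<omega>. \<phi> (Z \<omega>)) -` A \<inter> space M = Z -` B \<inter> space M \<and> B \<in> sets borel"
      by (intro exI[of _ "\<phi> -` A"]) auto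
  qed
  have "indep_var borel Y borel (\<lambda>\<omega>. \<phi> (Z \<omega>))"
    unfolding indep_var_def indep_vars_def2
  proof (intro conjI ballI)
    fix i :: bool
    show "random_variable (case_bool borel borel i) (case_bool Y (\<lambda>\<omega>. \<phi> (Z \<omega>)) i)"
      using YM measurable_compose[OF Z \<phi>] by (cases i) auto
    show "indep_sets (\<lambda>i. {case_bool Y (\<lambda>\<omega>. \<phi> (Z \<omega>)) i -` A \<inter> space M |A. A \<in> sets (case_bool borel borel i)}) UNIV"
      by (rule indep_sets_mono_sets[OF ind[unfolded indep_set_def]])
        (use sub1 sub2 in \<open>auto split: bool.splits\<close>)
  qed
  then have "integrable M (\<lambda>\<omega>. Y \<omega> * \<phi> (Z \<omega>))"
    "expectation (\<lambda>\<omega>. Y \<omega> * \<phi> (Z \<omega>)) = expectation Y * expectation (\<lambda>\<omega>. \<phi> (Z \<omega>))"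
    using Y' Z' by (auto intro!: indep_var_integrable indep_var_lebesgue_integral dest: has_bochner_integral_iff[THEN iffD1])
  then show ?thesis using Z' by (auto simp: has_bochner_integral_iff)
qed

lemma norm_power2_vec: "(norm (x :: real ^ 'n))\<^sup>2 = (\<Sum>i\<in>UNIV. (x $ i)\<^sup>2)"
  by (simp add: norm_vec_def L2_set_def sum_nonneg)

lemma norm_power2_matrix: "(norm (H :: real ^ 'd ^ 'n))\<^sup>2 = (\<Sum>i\<in>UNIV. \<Sum>q\<in>UNIV. (H $ i $ q)\<^sup>2)"
  by (simp add: norm_vec_def L2_set_def sum_nonneg)

text \<open>The expansion is arranged so that every term involving \<open>z\<close> is a coefficient
  built from \<open>S\<close> and \<open>H\<close> times a monomial in \<open>z\<close>, the shape
  that the factorization over independent increments accepts.\<close>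

lemma norm_power2_add_matrix_vector_mult:
  fixes H :: "real ^ 'd ^ 'n"
  shows "(norm (S + H *v z))\<^sup>2 = (norm S)\<^sup>2 + (\<Sum>i\<in>UNIV. \<Sum>q\<in>UNIV. 2 * (S $ i * H $ i $ q) * z $ q) +
    (\<Sum>i\<in>UNIV. \<Sum>q\<in>UNIV. \<Sum>r\<in>UNIV. (H $ i $ q * H $ i $ r) * (z $ q * z $ r))"
proof -
  have "(S $ i + (\<Sum>q\<in>UNIV. H $ i $ q * z $ q))\<^sup>2 = (S $ i)\<^sup>2 + (\<Sum>q\<in>UNIV. 2 * (S $ i * H $ i $ q) * z $ q) +
    (\<Sum>q\<in>UNIV. \<Sum>r\<in>UNIV. (H $ i $ q * H $ i $ r) * (z $ q * z $ r))" for i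
    by (simp add: power2_sum power2_eq_square[of "sum _ _"] sum_product sum_distrib_left mult_ac)
  then show ?thesis
    by (simp add: norm_power2_vec matrix_vector_mult_def sum.distrib)
qed

lemma borel_measurable_matrix_vector_mult [measurable (raw)]:
  fixes H :: "'a \<Rightarrow> real ^ 'd ^ 'n"
  assumes "H \<in> borel_measurable N" "z \<in> borel_measurable N"
  shows "(\<lambda>\<omega>. H \<omega> *v z \<omega>) \<in> borel_measurable N"
proof -
  have "continuous_on UNIV (\<lambda>p :: (real ^ 'd ^ 'n) \<times> _. fst p *v snd p)"
    unfolding matrix_vector_mult_def by (intro continuous_intros)
  from borel_measurable_continuous_Pair[OF assms this] show ?thesis by simp
qed

lemma borel_measurable_vec_nth [measurable (raw)]:
  fixes f :: "'a \<Rightarrow> ('b::euclidean_space) ^ 'n"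
  shows "f \<in> borel_measurable N \<Longrightarrow> (\<lambda>\<omega>. f \<omega> $ i) \<in> borel_measurable N"
  by (rule borel_measurable_continuous_on[where f="\<lambda>x. x $ i"]) (auto intro!: continuous_intros)

text \<open>From \<open>2 C x <= x^2 + C^2\<close>, where the constant is integrable because the
  measure is finite. It handles the mixed coefficients \<open>S $ i * H $ i $ q\<close>, in which
  \<open>S\<close> is only square integrable and \<open>H\<close> is bounded.\<close>

lemma (in prob_space) integrable_bounded_by_square_integrable:
  fixes f :: "'a \<Rightarrow> 'b::euclidean_space"
  assumes "f \<in> borel_measurable M" "h \<in> borel_measurable M" "integrable M (\<lambda>\<omega>. (norm (f \<omega>))\<^sup>2)"
    "\<And>\<omega>. \<omega> \<in> space M \<Longrightarrow> \<bar>h \<omega>\<bar> \<le> C * norm (f \<omega>)"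
  shows "integrable M (h :: 'a \<Rightarrow> real)"
proof (rule Bochner_Integration.integrable_bound[where f="\<lambda>\<omega>. (norm (f \<omega>))\<^sup>2 + C\<^sup>2"])
  show "AE \<omega> in M. norm (h \<omega>) \<le> norm ((norm (f \<omega>))\<^sup>2 + C\<^sup>2)"
  proof (rule AE_I2)
    fix \<omega> assume "\<omega> \<in> space M"
    from assms(4)[OF this] have "\<bar>h \<omega>\<bar> \<le> C * norm (f \<omega>)" .
    moreover have "2 * (C * norm (f \<omega>)) \<le> (norm (f \<omega>))\<^sup>2 + C\<^sup>2"
      using sum_squares_bound[of C "norm (f \<omega>)"] by simp
    moreover have "0 \<le> (norm (f \<omega>))\<^sup>2 + C\<^sup>2" by simp
    ultimately show "norm (h \<omega>) \<le> norm ((norm (f \<omega>))\<^sup>2 + C\<^sup>2)"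
      unfolding real_norm_def by linarith
  qed
qed (use assms in auto)

text \<open>One step of the isometry. The linear terms vanish since \<open>Z\<close> is centred, the
  mixed quadratic ones since its coordinates are uncorrelated, and the diagonal leaves
  \<open>\<delta>\<close> times the expected Frobenius square of \<open>H\<close>.\<close>

lemma (in prob_space) has_bochner_integral_norm_square_add_indep_increment:
  fixes Z :: "'a \<Rightarrow> real ^ 'd" and H :: "'a \<Rightarrow> real ^ 'd ^ 'n" and S :: "'a \<Rightarrow> real ^ 'n"
  assumes G: "subalgebra M G"
    and ind: "indep_set (sets G) {Z -` B \<inter> space M |B. B \<in> sets borel}"
    and Z: "Z \<in> borel_measurable M"
    and Z1: "\<And>q. has_bochner_integral M (\<lambda>\<omega>. Z \<omega> $ q) 0"
    and Z2: "\<And>q r. has_bochner_integral M (\<lambda>\<omega>. Z \<omega> $ q * Z \<omega> $ r) (if q = r then \<delta> else 0)"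
    and S: "S \<in> borel_measurable G" and H: "H \<in> borel_measurable G"
    and S2: "has_bochner_integral M (\<lambda>\<omega>. (norm (S \<omega>))\<^sup>2) s"
    and H_bd: "\<And>\<omega>. \<omega> \<in> space M \<Longrightarrow> norm (H \<omega>) \<le> C"
  shows "has_bochner_integral M (\<lambda>\<omega>. (norm (S \<omega> + H \<omega> *v Z \<omega>))\<^sup>2)
    (s + \<delta> * expectation (\<lambda>\<omega>. (norm (H \<omega>))\<^sup>2))"
proof -
  note [measurable] = S H
  have SM[measurable]: "S \<in> borel_measurable M" and HM[measurable]: "H \<in> borel_measurable M"
    using measurable_from_subalg[OF G S] measurable_from_subalg[OF G H] .
  have nth: "\<bar>H \<omega> $ i $ q\<bar> \<le> C" if "\<omega> \<in> space M" for \<omega> i q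
    using Finite_Cartesian_Product.norm_nth_le[of "H \<omega> $ i" q] Finite_Cartesian_Product.norm_nth_le[of "H \<omega>" i] H_bd[OF that] by simp
  \<comment> \<open>The bound on \<open>H\<close> lives on \<open>space M\<close>, so the sign of
    \<open>C\<close> comes from this space being nonempty.\<close>
  have C: "0 \<le> C" using H_bd not_empty norm_ge_zero order_trans by blast
  have SH: "integrable M (\<lambda>\<omega>. 2 * (S \<omega> $ i * H \<omega> $ i $ q))" for i q
  proof (rule integrable_bounded_by_square_integrable[where f=S and C="2 * C"])
    show "integrable M (\<lambda>\<omega>. (norm (S \<omega>))\<^sup>2)" using S2 by (auto simp: has_bochner_integral_iff)
    show "\<bar>2 * (S \<omega> $ i * H \<omega> $ i $ q)\<bar> \<le> 2 * C * norm (S \<omega>)" if "\<omega> \<in> space M" for \<omega>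
      using mult_mono[OF nth[OF that, of i q] Finite_Cartesian_Product.norm_nth_le[of "S \<omega>" i]] C by (simp add: abs_mult mult_ac)
  qed auto
  have HH: "integrable M (\<lambda>\<omega>. H \<omega> $ i $ q * H \<omega> $ i $ r)" for i q r
    by (rule integrable_const_bound[where B="C * C"])
      (use nth C in \<open>auto simp: abs_mult intro!: mult_mono\<close>)
  have "has_bochner_integral M (\<lambda>\<omega>. 2 * (S \<omega> $ i * H \<omega> $ i $ q) * Z \<omega> $ q) (expectation (\<lambda>\<omega>. 2 * (S \<omega> $ i * H \<omega> $ i $ q)) * 0)" for i q
    by (rule has_bochner_integral_mult_indep_subalgebra[OF G ind _ Z _ SH Z1]) auto
  moreover have "has_bochner_integral M (\<lambda>\<omega>. (H \<omega> $ i $ q * H \<omega> $ i $ r) * (Z \<omega> $ q * Z \<omega> $ r))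
      (expectation (\<lambda>\<omega>. H \<omega> $ i $ q * H \<omega> $ i $ r) * (if q = r then \<delta> else 0))" for i q r
    by (rule has_bochner_integral_mult_indep_subalgebra[OF G ind _ Z _ HH Z2]) auto
  \<comment> \<open>The value is first left as the literal sum of products, so that the introduction
    rules for sums apply; it is evaluated afterwards.\<close>
  ultimately have "has_bochner_integral M (\<lambda>\<omega>. (norm (S \<omega> + H \<omega> *v Z \<omega>))\<^sup>2)
     (s + (\<Sum>i\<in>(UNIV::'n set). \<Sum>q\<in>(UNIV::'d set). expectation (\<lambda>\<omega>. 2 * (S \<omega> $ i * H \<omega> $ i $ q)) * 0) +
     (\<Sum>i\<in>UNIV. \<Sum>q\<in>UNIV. \<Sum>r\<in>UNIV. expectation (\<lambda>\<omega>. H \<omega> $ i $ q * H \<omega> $ i $ r) * (if q = r then \<delta> else 0)))"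
    unfolding norm_power2_add_matrix_vector_mult using S2
    by (intro has_bochner_integral_add has_bochner_integral_sum) auto
  also have "(\<Sum>i\<in>(UNIV::'n set). \<Sum>q\<in>(UNIV::'d set). expectation (\<lambda>\<omega>. 2 * (S \<omega> $ i * H \<omega> $ i $ q)) * 0) = 0"
    by simp
  also have "(\<Sum>i\<in>UNIV. \<Sum>q\<in>UNIV. \<Sum>r\<in>UNIV. expectation (\<lambda>\<omega>. H \<omega> $ i $ q * H \<omega> $ i $ r) * (if q = r then \<delta> else 0))
     = (\<Sum>i\<in>UNIV. \<Sum>q\<in>UNIV. expectation (\<lambda>\<omega>. H \<omega> $ i $ q * H \<omega> $ i $ q) * \<delta>)"
    by (simp add: if_distrib sum.delta cong: if_cong)
  also have "\<dots> = \<delta> * expectation (\<lambda>\<omega>. (norm (H \<omega>))\<^sup>2)"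
    unfolding norm_power2_matrix unfolding power2_eq_square using HH
    by (simp add: sum_distrib_left mult_ac)
  finally show ?thesis by simp
qed

text \<open>For increasing \<open>p\<close>, the length of the part of the \<open>i\<close>-th
  partition interval before \<open>t\<close>. It is the variance of each coordinate of the increment
  that \<open>simple_integral\<close> uses, and is 0 once \<open>p i\<close> lies beyond
  \<open>t\<close>.\<close>

definition time_step :: "(nat \<Rightarrow> real) \<Rightarrow> real \<Rightarrow> nat \<Rightarrow> real" where
  "time_step p t i = min t (p (Suc i)) - min t (p i)"

text \<open>On the diagonal the second moment is the variance of the normal density; off the
  diagonal, independence of the coordinates factors the product into centred expectations.\<close>

lemma brownian_increment_moments:
  fixes W :: "real \<Rightarrow> 'a \<Rightarrow> real ^ 'd"
  assumes "prob_space M" "brownian_motion M T F W" "0 \<le> s" "s < t" "t \<le> T"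
  shows "has_bochner_integral M (\<lambda>\<omega>. (W t \<omega> - W s \<omega>) $ q) 0"
    and "has_bochner_integral M (\<lambda>\<omega>. (W t \<omega> - W s \<omega>) $ q * (W t \<omega> - W s \<omega>) $ r)
      (if q = r then t - s else 0)"
proof -
  interpret prob_space M by fact
  let ?Z = "\<lambda>q \<omega>. (W t \<omega> - W s \<omega>) $ q"
  let ?\<sigma> = "sqrt (t - s)"
  have dist: "distributed M lborel (?Z q) (normal_density 0 ?\<sigma>)" for q
    using assms unfolding brownian_motion_def by blast
  have ind: "indep_vars (\<lambda>_. borel) ?Z UNIV"
    using assms unfolding brownian_motion_def by blast
  have \<sigma>: "0 < ?\<sigma>" using assms by simp
  \<comment> \<open>Powers of a coordinate are integrated against its density, which carries the
    moments on the real line over to \<open>M\<close>.\<close>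
  have mom: "has_bochner_integral M (\<lambda>\<omega>. ?Z q \<omega> ^ k) m"
    if "has_bochner_integral lborel (\<lambda>x. normal_density 0 ?\<sigma> x * x ^ k) m" for q k m
    using that distributed_integrable[OF dist, of "\<lambda>x. x ^ k" q] distributed_integral[OF dist, of "\<lambda>x. x ^ k" q]
    by (auto simp: has_bochner_integral_iff)
  have 1: "has_bochner_integral M (?Z q) 0" for q
    using mom[of 1 0 q] normal_moment_odd[OF \<sigma>, of 0 0] by simp
  then show "has_bochner_integral M (?Z q) 0" .
  \<comment> \<open>\<open>normal_moment_even\<close> for the second power gives
    \<open>2 / (2 / (t - s))\<close>.\<close>
  have 2: "has_bochner_integral M (\<lambda>\<omega>. ?Z q \<omega> ^ 2) (t - s)" for q
    using mom[of 2 "t - s" q] normal_moment_even[OF \<sigma>, of 0 1] assms by (simp add: diff_divide_distrib)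
  show "has_bochner_integral M (\<lambda>\<omega>. ?Z q \<omega> * ?Z r \<omega>) (if q = r then t - s else 0)"
  proof (cases "q = r")
    case True then show ?thesis using 2 by (simp add: power2_eq_square)
  next
    case False
    have ind': "indep_vars (\<lambda>_. borel) ?Z {q, r}"
      using ind by (rule indep_vars_subset) simp
    have "integrable M (\<lambda>\<omega>. \<Prod>i\<in>{q, r}. ?Z i \<omega>)"
      "expectation (\<lambda>\<omega>. \<Prod>i\<in>{q, r}. ?Z i \<omega>) = (\<Prod>i\<in>{q, r}. expectation (?Z i))"
      using 1 by (intro indep_vars_integrable[OF _ ind'] indep_vars_lebesgue_integral[OF _ ind'];
        auto simp: has_bochner_integral_iff)+
    then show ?thesis using 1[of q] False by (simp add: has_bochner_integral_iff)
  qed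
qed

section \<open>Partitions and the isometry along them\<close>

lemma simple_integrand_mono:
  assumes "simple_integrand M T F k p H" "i \<le> j" "j \<le> k"
  shows "p i \<le> p j"
  using assms(2,3)
proof (induction j rule: dec_induct)
  case (step n)
  with assms(1) have "p n < p (Suc n)" by (auto simp: simple_integrand_def)
  then show ?case using step by simp
qed simp

lemma simple_integrand_range:
  assumes "simple_integrand M T F k p H" "i \<le> k"
  shows "0 \<le> p i" "p i \<le> T"
  using simple_integrand_mono[OF assms(1), of 0 i] simple_integrand_mono[OF assms(1), of i k] assms
  by (auto simp: simple_integrand_def)

lemma usual_filtration_measurable_mono:
  assumes F: "usual_filtration M T F" and "0 \<le> s" "s \<le> t" "t \<le> T" and f: "f \<in> measurable (F s) N"
  shows "f \<in> measurable (F t) N"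
proof -
  have sets: "sets (F s) \<subseteq> sets (F t)" and "subalgebra M (F s)" "subalgebra M (F t)"
    using F assms(2-4) unfolding usual_filtration_def by auto
  then have "subalgebra (F t) (F s)" by (auto simp: subalgebra_def)
  from measurable_from_subalg[OF this f] show ?thesis .
qed

text \<open>Induction on the number of steps. The partial sum over the first \<open>m\<close> steps
  is known at time \<open>p m\<close>, hence independent of the next increment, and the one-step
  lemma adds the next summand. Measurability at \<open>p m\<close> is therefore carried along in the
  induction.\<close>

lemma simple_integral_isometry:
  fixes W :: "real \<Rightarrow> 'a \<Rightarrow> real ^ 'd" and H :: "nat \<Rightarrow> 'a \<Rightarrow> real ^ 'd ^ 'n"
  assumes P: "prob_space M" and F: "usual_filtration M T F" and W: "brownian_motion M T F W"
    and H: "simple_integrand M T F k p H" and t: "0 \<le> t" "t \<le> T"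
  shows "has_bochner_integral M (\<lambda>\<omega>. (norm (simple_integral W k p H t \<omega>))\<^sup>2)
    (\<Sum>i<k. time_step p t i * (\<integral>\<omega>. (norm (H i \<omega>))\<^sup>2 \<partial>M))"
proof -
  interpret prob_space M by fact
  define S where "S m \<omega> = (\<Sum>i<m. H i \<omega> *v (W (min t (p (Suc i))) \<omega> - W (min t (p i)) \<omega>))" for m \<omega>
  have sub: "subalgebra M (F s)" if "0 \<le> s" "s \<le> T" for s
    using F that by (auto simp: usual_filtration_def)
  have Wm: "W s \<in> borel_measurable (F s')" if "0 \<le> s" "s \<le> s'" "s' \<le> T" for s s'
    using usual_filtration_measurable_mono[OF F that, of "W s" borel] W that
    by (auto simp: brownian_motion_def adapted_def)
  have Hm: "H i \<in> borel_measurable (F s)" if "i < k" "p i \<le> s" "s \<le> T" for i s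
    using usual_filtration_measurable_mono[OF F _ that(2,3), of "H i" borel] H that
      simple_integrand_range[OF H, of i]
    by (auto simp: simple_integrand_def)
  obtain C where C: "\<And>i \<omega>. i < k \<Longrightarrow> \<omega> \<in> space M \<Longrightarrow> norm (H i \<omega>) \<le> C"
    using H unfolding simple_integrand_def by blast
  have "S m \<in> borel_measurable (F (p m)) \<and> has_bochner_integral M (\<lambda>\<omega>. (norm (S m \<omega>))\<^sup>2)
      (\<Sum>i<m. time_step p t i * (\<integral>\<omega>. (norm (H i \<omega>))\<^sup>2 \<partial>M))" if "m \<le> k" for m
    using that
  proof (induction m)
    case 0
    then show ?case by (simp add: S_def[abs_def] has_bochner_integral_zero)
  next
    case (Suc m)
    let ?Z = "\<lambda>\<omega>. W (min t (p (Suc m))) \<omega> - W (min t (p m)) \<omega>"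
    have mk: "m < k" using Suc by simp
    have pm: "p m < p (Suc m)" using H mk by (auto simp: simple_integrand_def)
    note r = simple_integrand_range[OF H, of m] simple_integrand_range[OF H, of "Suc m"]
    have SS: "S (Suc m) = (\<lambda>\<omega>. S m \<omega> + H m \<omega> *v ?Z \<omega>)" by (simp add: S_def[abs_def])
    have IH: "S m \<in> borel_measurable (F (p m))" "has_bochner_integral M (\<lambda>\<omega>. (norm (S m \<omega>))\<^sup>2)
      (\<Sum>i<m. time_step p t i * (\<integral>\<omega>. (norm (H i \<omega>))\<^sup>2 \<partial>M))" using Suc by auto
    have [measurable]: "S m \<in> borel_measurable (F (p (Suc m)))"
      using usual_filtration_measurable_mono[OF F _ _ _ IH(1), of "p (Suc m)"] r pm mk by simp
    have [measurable]: "H m \<in> borel_measurable (F (p (Suc m)))" using Hm[of m] mk pm r by simp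
    have [measurable]: "W (min t (p (Suc m))) \<in> borel_measurable (F (p (Suc m)))"
      "W (min t (p m)) \<in> borel_measurable (F (p (Suc m)))" using Wm t r pm mk by auto
    have "S (Suc m) \<in> borel_measurable (F (p (Suc m)))" unfolding SS by measurable
    moreover have "has_bochner_integral M (\<lambda>\<omega>. (norm (S (Suc m) \<omega>))\<^sup>2)
      (\<Sum>i<Suc m. time_step p t i * (\<integral>\<omega>. (norm (H i \<omega>))\<^sup>2 \<partial>M))"
    proof (cases "t \<le> p m")
      case True
      then have "min t (p (Suc m)) = t" "min t (p m) = t" using pm by auto
      then show ?thesis using IH by (simp add: SS time_step_def)
    next
      case False
      then have eq: "min t (p m) = p m" by simp
      \<comment> \<open>Only for \<open>t > p m\<close> is there an increment to account for. It
        runs from \<open>p m\<close> to \<open>u\<close>, and \<open>p m < u\<close> is strict, as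
        \<open>brownian_increment_moments\<close> requires.\<close>
      define u where "u = min t (p (Suc m))"
      have u: "0 \<le> p m" "p m < u" "u \<le> T" using False pm r mk t by (auto simp: u_def)
      have "has_bochner_integral M (\<lambda>\<omega>. (norm (S m \<omega> + H m \<omega> *v (W u \<omega> - W (p m) \<omega>)))\<^sup>2)
        ((\<Sum>i<m. time_step p t i * (\<integral>\<omega>. (norm (H i \<omega>))\<^sup>2 \<partial>M)) + (u - p m) * expectation (\<lambda>\<omega>. (norm (H m \<omega>))\<^sup>2))"
      proof (rule has_bochner_integral_norm_square_add_indep_increment)
        show "subalgebra M (F (p m))" using sub u by simp
        show "indep_set (sets (F (p m))) {(\<lambda>\<omega>. W u \<omega> - W (p m) \<omega>) -` B \<inter> space M |B. B \<in> sets borel}"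
          using W u unfolding brownian_motion_def by blast
        have "W u \<in> borel_measurable M" "W (p m) \<in> borel_measurable M"
          using measurable_from_subalg[OF sub Wm, of u u] measurable_from_subalg[OF sub Wm, of u "p m"] u by auto
        then show "(\<lambda>\<omega>. W u \<omega> - W (p m) \<omega>) \<in> borel_measurable M" by measurable
        show "H m \<in> borel_measurable (F (p m))" using Hm mk u by simp
      qed (use brownian_increment_moments[OF P W u] C mk IH in auto)
      then show ?thesis by (simp add: SS time_step_def eq u_def)
    qed
    ultimately show ?case by simp
  qed
  from this[of k] show ?thesis by (simp add: S_def simple_integral_def)
qed

text \<open>The intervals \<open>{p i<..p (Suc i)}\<close> are disjoint, so at each time at most one
  summand is nonzero and squaring produces no mixed terms.\<close>

lemma norm_simple_process_square:
  assumes "simple_integrand M T F k p H"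
  shows "(norm (simple_process k p H s \<omega>))\<^sup>2 = (\<Sum>i<k. (norm (H i \<omega>))\<^sup>2 * indicator {p i<..p (Suc i)} s)"
proof (cases "\<exists>i<k. s \<in> {p i<..p (Suc i)}")
  case True
  then obtain i where i: "i < k" "p i < s" "s \<le> p (Suc i)" by auto
  have "indicator {p j<..p (Suc j)} s = (if j = i then 1 else 0 :: real)" if "j < k" for j
  proof -
    \<comment> \<open>Phrased with \<open>Suc\<close> so that monotonicity of \<open>p\<close>
      separates the intervals: \<open>p (Suc j) <= p i < s\<close> in the second case,
      \<open>s <= p (Suc i) <= p j\<close> in the third.\<close>
    consider "j = i" | "Suc j \<le> i" | "Suc i \<le> j" by linarith
    then show ?thesis
    proof cases
      case 2
      with simple_integrand_mono[OF assms 2] i show ?thesis by (auto simp: indicator_def)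
    next
      case 3
      with simple_integrand_mono[OF assms 3] i that show ?thesis by (auto simp: indicator_def)
    qed (use i in auto)
  qed
  then have "simple_process k p H s \<omega> = (\<Sum>j<k. (if j = i then 1 else 0) *\<^sub>R H j \<omega>)"
    "(\<Sum>j<k. (norm (H j \<omega>))\<^sup>2 * indicator {p j<..p (Suc j)} s) = (\<Sum>j<k. (norm (H j \<omega>))\<^sup>2 * (if j = i then 1 else 0))"
    unfolding simple_process_def by (auto intro!: sum.cong)
  then show ?thesis using i by (simp add: if_distrib if_distribR sum.delta cong: if_cong)
next
  case False
  then have "indicator {p j<..p (Suc j)} s = (0 :: real)" if "j < k" for j
    using that by (auto simp: indicator_def)
  then show ?thesis by (simp add: simple_process_def)
qed

section \<open>The accumulated square of a simple integrand and its truncation\<close>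

lemma time_step_nonneg: "p i \<le> p (Suc i) \<Longrightarrow> 0 \<le> time_step p t i"
  by (auto simp: time_step_def)

lemma simple_integrand_time_step_nonneg:
  "simple_integrand M T F k p H \<Longrightarrow> i < k \<Longrightarrow> 0 \<le> time_step p t i"
  by (auto intro!: time_step_nonneg simp: simple_integrand_def less_imp_le)

text \<open>This turns the accumulated square, on which the truncation acts, into a time integral
  that can be compared with the mean square distance to the integrand.\<close>

lemma nn_integral_simple_process:
  assumes H: "simple_integrand M T F k p H" and t: "0 \<le> t"
  shows "(\<integral>\<^sup>+s\<in>{0..t}. ennreal ((norm (simple_process k p H s \<omega>))\<^sup>2) \<partial>lborel) =
    ennreal (\<Sum>i<k. time_step p t i * (norm (H i \<omega>))\<^sup>2)"
proof -
  have eq: "ennreal ((norm (simple_process k p H s \<omega>))\<^sup>2) * indicator {0..t} s =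
      (\<Sum>i<k. ennreal ((norm (H i \<omega>))\<^sup>2) * indicator {min t (p i)<..min t (p (Suc i))} s)" for s
  proof -
    have "ennreal (\<Sum>i<k. (norm (H i \<omega>))\<^sup>2 * indicator {p i<..p (Suc i)} s) =
      (\<Sum>i<k. ennreal ((norm (H i \<omega>))\<^sup>2 * indicator {p i<..p (Suc i)} s))"
      by (rule sum_ennreal[symmetric]) simp
    also have "\<dots> = (\<Sum>i<k. ennreal ((norm (H i \<omega>))\<^sup>2) * indicator {p i<..p (Suc i)} s)"
      by (intro sum.cong) (auto simp: indicator_def)
    finally have "ennreal ((norm (simple_process k p H s \<omega>))\<^sup>2) * indicator {0..t} s =
      (\<Sum>i<k. ennreal ((norm (H i \<omega>))\<^sup>2) * (indicator {p i<..p (Suc i)} s * indicator {0..t} s))"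
      unfolding norm_simple_process_square[OF H] by (simp only: sum_distrib_right mult.assoc)
    \<comment> \<open>The upper end of \<open>{0..t}\<close> becomes the cap \<open>min t\<close>;
      the lower end is automatic because \<open>0 <= p i < s\<close>.\<close>
    also have "\<dots> = (\<Sum>i<k. ennreal ((norm (H i \<omega>))\<^sup>2) * indicator {min t (p i)<..min t (p (Suc i))} s)"
    proof (intro sum.cong refl arg_cong2[where f="(*)"])
      fix i assume "i \<in> {..<k}"
      with simple_integrand_range[OF H, of i] t
      show "indicator {p i<..p (Suc i)} s * indicator {0..t} s =
          (indicator {min t (p i)<..min t (p (Suc i))} s :: ennreal)"
        by (auto simp: indicator_def)
    qed
    finally show ?thesis .
  qed
  have "(\<integral>\<^sup>+s\<in>{0..t}. ennreal ((norm (simple_process k p H s \<omega>))\<^sup>2) \<partial>lborel) =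
    (\<Sum>i<k. ennreal ((norm (H i \<omega>))\<^sup>2) * ennreal (time_step p t i))"
    unfolding eq
  proof (subst nn_integral_sum, simp, intro sum.cong refl)
    fix i assume "i \<in> {..<k}"
    then have "p i < p (Suc i)" using H by (simp add: simple_integrand_def)
    then have "min t (p i) \<le> min t (p (Suc i))" by linarith
    then show "(\<integral>\<^sup>+ s. ennreal ((norm (H i \<omega>))\<^sup>2) * indicator {min t (p i)<..min t (p (Suc i))} s \<partial>lborel) =
        ennreal ((norm (H i \<omega>))\<^sup>2) * ennreal (time_step p t i)"
      by (simp add: nn_integral_cmult_indicator time_step_def)
  qed
  also have "\<dots> = ennreal (\<Sum>i<k. time_step p t i * (norm (H i \<omega>))\<^sup>2)"
    using simple_integrand_time_step_nonneg[OF H]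
    by (subst sum_ennreal[symmetric]) (auto simp: ennreal_mult mult.commute)
  finally show ?thesis .
qed

text \<open>Each summand of the accumulated square up to and including step \<open>i\<close> is known at time \<open>p i\<close>, so
  cutting the integrand off once this sum would exceed \<open>c\<close> keeps it nonanticipating.\<close>

lemma simple_integral_truncation:
  fixes W :: "real \<Rightarrow> 'a \<Rightarrow> real ^ 'd" and H :: "nat \<Rightarrow> 'a \<Rightarrow> real ^ 'd ^ 'n"
  assumes P: "prob_space M" and F: "usual_filtration M T F" and W: "brownian_motion M T F W"
    and H: "simple_integrand M T F k p H" and t: "0 \<le> t" "t \<le> T" and c: "0 \<le> c"
  obtains J where "J \<in> borel_measurable M"
    "\<And>\<omega>. (\<Sum>i<k. time_step p t i * (norm (H i \<omega>))\<^sup>2) \<le> c \<Longrightarrow> J \<omega> = simple_integral W k p H t \<omega>"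
    "(\<integral>\<^sup>+\<omega>. ennreal ((norm (J \<omega>))\<^sup>2) \<partial>M) \<le>
      (\<integral>\<^sup>+\<omega>. ennreal (min c (\<Sum>i<k. time_step p t i * (norm (H i \<omega>))\<^sup>2)) \<partial>M)"
proof -
  interpret prob_space M by fact
  define q where "q m \<omega> = (\<Sum>i<m. time_step p t i * (norm (H i \<omega>))\<^sup>2)" for m \<omega>
  define G where "G i \<omega> = (if q (Suc i) \<omega> \<le> c then H i \<omega> else 0)" for i \<omega>
  have sub: "subalgebra M (F s)" if "0 \<le> s" "s \<le> T" for s
    using F that by (auto simp: usual_filtration_def)
  have Hm: "H i \<in> borel_measurable (F s)" if "i < k" "p i \<le> s" "s \<le> T" for i s
    using usual_filtration_measurable_mono[OF F _ that(2,3), of "H i" borel] H that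
      simple_integrand_range[OF H, of i]
    by (auto simp: simple_integrand_def)
  note nonneg = simple_integrand_time_step_nonneg[OF H]
  have G: "simple_integrand M T F k p G"
    unfolding simple_integrand_def
  proof (intro conjI allI impI)
    fix i assume i: "i < k"
    have "H l \<in> borel_measurable (F (p i))" if "l < Suc i" for l
      using Hm[of l "p i"] that i simple_integrand_mono[OF H, of l i] simple_integrand_range[OF H, of i] by auto
    then have "q (Suc i) \<in> borel_measurable (F (p i))"
      unfolding q_def[abs_def] by (intro borel_measurable_sum borel_measurable_times borel_measurable_power borel_measurable_norm borel_measurable_const) auto
    moreover have "H i \<in> borel_measurable (F (p i))"
      using Hm[of i "p i"] i simple_integrand_range[OF H, of i] by auto
    ultimately show "G i \<in> borel_measurable (F (p i))" unfolding G_def[abs_def] by measurable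
  next
    show "\<exists>C. \<forall>i<k. \<forall>\<omega>\<in>space M. norm (G i \<omega>) \<le> C"
    proof -
      obtain C where C: "\<And>i \<omega>. i < k \<Longrightarrow> \<omega> \<in> space M \<Longrightarrow> norm (H i \<omega>) \<le> C"
        using H unfolding simple_integrand_def by blast
      then have "norm (G i \<omega>) \<le> \<bar>C\<bar>" if "i < k" "\<omega> \<in> space M" for i \<omega>
        using C[OF that] by (auto simp: G_def)
      then show ?thesis by blast
    qed
  qed (use H in \<open>auto simp: simple_integrand_def\<close>)
  have q_mono: "q i \<omega> \<le> q j \<omega>" if "i \<le> j" "j \<le> k" for i j \<omega>
    unfolding q_def using that nonneg by (intro sum_mono2) auto
  have G_le: "time_step p t i * (norm (G i \<omega>))\<^sup>2 \<le> time_step p t i * (norm (H i \<omega>))\<^sup>2" if "i < k" for i \<omega>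
    using nonneg[OF that] by (auto simp: G_def intro!: mult_left_mono)
  \<comment> \<open>There is no overshoot, because the cutoff test includes the current step: if it
    succeeds, the sum is at most \<open>q (Suc m) \<omega>\<close>; if it fails, the new summand is
    0.\<close>
  have G_c: "(\<Sum>i<m. time_step p t i * (norm (G i \<omega>))\<^sup>2) \<le> c" if "m \<le> k" for m \<omega>
    using that
  proof (induction m)
    case (Suc m)
    show ?case
    proof (cases "q (Suc m) \<omega> \<le> c")
      case True
      have "(\<Sum>i<Suc m. time_step p t i * (norm (G i \<omega>))\<^sup>2) \<le> q (Suc m) \<omega>"
        unfolding q_def using G_le Suc by (intro sum_mono) auto
      then show ?thesis using True by simp
    next
      case False
      then show ?thesis using Suc by (simp add: G_def[of m])
    qed
  qed (use c in simp)
  have G_min: "(\<Sum>i<k. time_step p t i * (norm (G i \<omega>))\<^sup>2) \<le> min c (q k \<omega>)" for \<omega>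
    using G_c[of k \<omega>] G_le unfolding q_def by (auto intro!: sum_mono)
  have GM: "G i \<in> borel_measurable M" if "i < k" for i
    using G that measurable_from_subalg[OF sub, of "p i" "G i" borel] simple_integrand_range[OF H, of i]
    by (auto simp: simple_integrand_def)
  have G2: "integrable M (\<lambda>\<omega>. (norm (G i \<omega>))\<^sup>2)" if "i < k" for i
  proof -
    obtain C where C: "\<And>i \<omega>. i < k \<Longrightarrow> \<omega> \<in> space M \<Longrightarrow> norm (G i \<omega>) \<le> C"
      using G unfolding simple_integrand_def by blast
    show ?thesis
      by (rule integrable_const_bound[where B="C\<^sup>2"])
        (use GM[OF that] C[OF that] in \<open>auto intro!: power_mono\<close>)
  qed
  show ?thesis
  proof
    have WM: "W s \<in> borel_measurable M" if "0 \<le> s" "s \<le> T" for s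
      using measurable_from_subalg[OF sub, of s "W s"] W that by (auto simp: brownian_motion_def adapted_def)
    show "simple_integral W k p G t \<in> borel_measurable M"
      unfolding simple_integral_def[abs_def]
    proof (intro borel_measurable_sum borel_measurable_matrix_vector_mult borel_measurable_diff)
      fix i assume "i \<in> {..<k}"
      then show "G i \<in> borel_measurable M" "W (min t (p (Suc i))) \<in> borel_measurable M" "W (min t (p i)) \<in> borel_measurable M"
        using GM WM t simple_integrand_range[OF H, of i] simple_integrand_range[OF H, of "Suc i"] by auto
    qed
    show "simple_integral W k p G t \<omega> = simple_integral W k p H t \<omega>"
      if le: "(\<Sum>i<k. time_step p t i * (norm (H i \<omega>))\<^sup>2) \<le> c" for \<omega>
    proof -
      \<comment> \<open>The partial sums increase, so a total of at most \<open>c\<close> means that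
        no step was cut off.\<close>
      have "q (Suc i) \<omega> \<le> c" if "i < k" for i
        using q_mono[of "Suc i" k \<omega>] that le by (simp add: q_def)
      then have "G i \<omega> = H i \<omega>" if "i < k" for i using that by (simp add: G_def)
      then show ?thesis by (simp add: simple_integral_def)
    qed
    have "has_bochner_integral M (\<lambda>\<omega>. (norm (simple_integral W k p G t \<omega>))\<^sup>2)
        (\<Sum>i<k. time_step p t i * (\<integral>\<omega>. (norm (G i \<omega>))\<^sup>2 \<partial>M))"
      by (rule simple_integral_isometry[OF P F W G t])
    then have "(\<integral>\<^sup>+\<omega>. ennreal ((norm (simple_integral W k p G t \<omega>))\<^sup>2) \<partial>M) =
        ennreal (\<Sum>i<k. time_step p t i * (\<integral>\<omega>. (norm (G i \<omega>))\<^sup>2 \<partial>M))"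
      by (simp add: nn_integral_eq_integral has_bochner_integral_iff)
    also have "\<dots> = ennreal (\<integral>\<omega>. (\<Sum>i<k. time_step p t i * (norm (G i \<omega>))\<^sup>2) \<partial>M)"
      using G2 by simp
    also have "\<dots> = (\<integral>\<^sup>+\<omega>. ennreal (\<Sum>i<k. time_step p t i * (norm (G i \<omega>))\<^sup>2) \<partial>M)"
      using G2 nonneg by (intro nn_integral_eq_integral[symmetric]) (auto intro!: sum_nonneg)
    also have "\<dots> \<le> (\<integral>\<^sup>+\<omega>. ennreal (min c (q k \<omega>)) \<partial>M)"
      using G_min by (intro nn_integral_mono ennreal_leI)
    finally show "(\<integral>\<^sup>+\<omega>. ennreal ((norm (simple_integral W k p G t \<omega>))\<^sup>2) \<partial>M) \<le>
      (\<integral>\<^sup>+\<omega>. ennreal (min c (\<Sum>i<k. time_step p t i * (norm (H i \<omega>))\<^sup>2)) \<partial>M)"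
      by (simp add: q_def)
  qed
qed

text \<open>No measurability of \<open>\<phi>\<close> is assumed, so the triangle inequality goes through the measurable
  minorant \<open>max 0 (|h|\<^sup>2 / 2 - D)\<close> of \<open>|h - \<phi>|\<^sup>2\<close>.\<close>

lemma nn_integral_norm_square_le:
  fixes h \<phi> :: "real \<Rightarrow> 'b::euclidean_space"
  assumes h: "h \<in> borel_measurable borel" and D: "D \<in> borel_measurable borel"
    and \<phi>: "\<And>s. s \<in> A \<Longrightarrow> (norm (\<phi> s))\<^sup>2 \<le> D s" and A: "A \<in> sets borel"
  shows "(\<integral>\<^sup>+s\<in>A. ennreal ((norm (h s))\<^sup>2) \<partial>lborel) \<le>
    2 * (\<integral>\<^sup>+s\<in>A. ennreal (D s) \<partial>lborel) + 2 * (\<integral>\<^sup>+s\<in>A. ennreal ((norm (h s - \<phi> s))\<^sup>2) \<partial>lborel)"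
proof -
  note [measurable] = h D A
  let ?m = "\<lambda>s. max 0 ((norm (h s))\<^sup>2 / 2 - D s)"
  have m: "?m s \<le> (norm (h s - \<phi> s))\<^sup>2" if "s \<in> A" for s
  proof -
    have "norm (h s) \<le> norm (h s - \<phi> s) + norm (\<phi> s)"
      using norm_triangle_sub[of "h s" "\<phi> s"] by simp
    then have "(norm (h s))\<^sup>2 \<le> (norm (h s - \<phi> s) + norm (\<phi> s))\<^sup>2" by (intro power_mono) auto
    also have "\<dots> \<le> 2 * (norm (h s - \<phi> s))\<^sup>2 + 2 * (norm (\<phi> s))\<^sup>2"
      using sum_squares_bound[of "norm (h s - \<phi> s)" "norm (\<phi> s)"] by (simp add: power2_sum)
    finally show ?thesis using \<phi>[OF that] by simp
  qed
  have "(\<integral>\<^sup>+s\<in>A. ennreal ((norm (h s))\<^sup>2) \<partial>lborel) \<le>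
    (\<integral>\<^sup>+s. 2 * (ennreal (D s) * indicator A s) + 2 * (ennreal (?m s) * indicator A s) \<partial>lborel)"
  proof (rule nn_integral_mono)
    fix s
    show "ennreal ((norm (h s))\<^sup>2) * indicator A s \<le> 2 * (ennreal (D s) * indicator A s) + 2 * (ennreal (?m s) * indicator A s)"
    proof (cases "s \<in> A")
      case True
      have "0 \<le> D s" using \<phi>[OF True] order_trans zero_le_power2 by blast
      then have "2 * ennreal (D s) + 2 * ennreal (?m s) = ennreal (2 * D s + 2 * ?m s)"
        by (simp add: ennreal_plus ennreal_mult)
      moreover have "(norm (h s))\<^sup>2 \<le> 2 * D s + 2 * ?m s" by (simp add: max_def)
      ultimately show ?thesis using True by (simp add: ennreal_leI)
    qed simp
  qed
  also have "\<dots> = 2 * (\<integral>\<^sup>+s\<in>A. ennreal (D s) \<partial>lborel) + 2 * (\<integral>\<^sup>+s\<in>A. ennreal (?m s) \<partial>lborel)"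
    by (simp add: nn_integral_add nn_integral_cmult)
  also have "\<dots> \<le> 2 * (\<integral>\<^sup>+s\<in>A. ennreal (D s) \<partial>lborel) + 2 * (\<integral>\<^sup>+s\<in>A. ennreal ((norm (h s - \<phi> s))\<^sup>2) \<partial>lborel)"
    using m by (intro add_left_mono mult_left_mono nn_integral_mono) (auto simp: indicator_def intro!: ennreal_leI)
  finally show ?thesis .
qed

section \<open>Convergence in probability\<close>

text \<open>The capped variable is at most \<open>\<epsilon>\<close> outside the event
  \<open>Z j > \<epsilon>\<close>, and at most \<open>c\<close> on this event, whose probability
  tends to 0.\<close>

lemma tends_to_0_in_probability_nn_integral_min:
  assumes "prob_space M" and Z: "tends_to_0_in_probability M Z" and c: "0 \<le> c"
  shows "(\<lambda>j. \<integral>\<^sup>+\<omega>. min (ennreal c) (Z j \<omega>) \<partial>M) \<longlonglongrightarrow> 0"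
proof -
  interpret prob_space M by fact
  have Zm[measurable]: "Z j \<in> borel_measurable M" for j
    using Z by (simp add: tends_to_0_in_probability_def)
  have bound: "(\<integral>\<^sup>+\<omega>. min (ennreal c) (Z j \<omega>) \<partial>M) \<le> ennreal (\<epsilon> + c * prob {\<omega> \<in> space M. Z j \<omega> > ennreal \<epsilon>})"
    if "\<epsilon> > 0" for \<epsilon> j
  proof -
    let ?B = "{\<omega> \<in> space M. Z j \<omega> > ennreal \<epsilon>}"
    have "(\<integral>\<^sup>+\<omega>. min (ennreal c) (Z j \<omega>) \<partial>M) \<le> (\<integral>\<^sup>+\<omega>. ennreal \<epsilon> + ennreal c * indicator ?B \<omega> \<partial>M)"
    proof (intro nn_integral_mono)
      fix \<omega> assume "\<omega> \<in> space M"
      then show "min (ennreal c) (Z j \<omega>) \<le> ennreal \<epsilon> + ennreal c * indicator ?B \<omega>"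
        by (cases "ennreal \<epsilon> < Z j \<omega>") (auto simp: min.coboundedI1 min.coboundedI2 not_less)
    qed
    also have "\<dots> = ennreal \<epsilon> + ennreal c * emeasure M ?B"
      by (subst nn_integral_add) (auto simp: emeasure_space_1 nn_integral_cmult_indicator)
    also have "\<dots> = ennreal (\<epsilon> + c * prob ?B)"
      using that c by (simp add: emeasure_eq_measure ennreal_mult ennreal_plus)
    finally show ?thesis .
  qed
  show ?thesis
  proof (rule order_tendstoI)
    fix a :: ennreal assume "0 < a"
    \<comment> \<open>\<open>a\<close> may be infinite; an intermediate point is finite and supplies
      a real \<open>\<delta>\<close>.\<close>
    then obtain x where x: "0 < x" "x < a" using dense by blast
    then have "x < \<top>" using less_le_trans top_greatest by blast
    with x obtain \<delta> where \<delta>: "0 < \<delta>" "ennreal \<delta> < a"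
      by (cases x) auto
    \<comment> \<open>Splitting at \<open>\<delta> / 2\<close> makes the limit of the bound
      \<open>\<delta> / 2\<close>, strictly below \<open>\<delta>\<close>.\<close>
    have "(\<lambda>j. \<delta> / 2 + c * prob {\<omega> \<in> space M. Z j \<omega> > ennreal (\<delta> / 2)}) \<longlonglongrightarrow> \<delta> / 2 + c * 0"
      using Z \<delta> by (intro tendsto_intros) (auto simp: tends_to_0_in_probability_def)
    from order_tendstoD(2)[OF this, of \<delta>]
    have "eventually (\<lambda>j. \<delta> / 2 + c * prob {\<omega> \<in> space M. Z j \<omega> > ennreal (\<delta> / 2)} < \<delta>) sequentially"
      using \<delta> by simp
    then show "eventually (\<lambda>j. (\<integral>\<^sup>+\<omega>. min (ennreal c) (Z j \<omega>) \<partial>M) < a) sequentially"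
    proof eventually_elim
      case (elim j)
      have "(\<integral>\<^sup>+\<omega>. min (ennreal c) (Z j \<omega>) \<partial>M) \<le> ennreal (\<delta> / 2 + c * prob {\<omega> \<in> space M. Z j \<omega> > ennreal (\<delta> / 2)})"
        using bound[of "\<delta> / 2" j] \<delta> by simp
      also have "\<dots> \<le> ennreal \<delta>" using elim by (intro ennreal_leI) simp
      finally show ?case using \<delta> by simp
    qed
  qed simp
qed

text \<open>Capped at 1, both sequences converge to 0 in mean, and so does their sum
  \<open>u\<close>. Extracting an almost surely convergent subsequence of \<open>u\<close> serves
  both sequences at once.\<close>

lemma tends_to_0_in_probability_AE_subseq:
  assumes "prob_space M" and Z: "tends_to_0_in_probability M Z" and Y: "tends_to_0_in_probability M Y"
  obtains r where "strict_mono r"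
    "AE \<omega> in M. (\<lambda>j. Z (r j) \<omega>) \<longlonglongrightarrow> 0 \<and> (\<lambda>j. Y (r j) \<omega>) \<longlonglongrightarrow> 0"
proof -
  interpret prob_space M by fact
  have [measurable]: "Z j \<in> borel_measurable M" "Y j \<in> borel_measurable M" for j
    using Z Y by (simp_all add: tends_to_0_in_probability_def)
  define u where "u j \<omega> = min 1 (Z j \<omega>) + min 1 (Y j \<omega>)" for j \<omega>
  have u2: "u j \<omega> \<le> 2" for j \<omega>
    using add_mono[of "min 1 (Z j \<omega>)" 1 "min 1 (Y j \<omega>)" 1] by (simp add: u_def)
  then have u_top: "u j \<omega> < \<top>" for j \<omega> by (rule le_less_trans) simp
  have [measurable]: "u j \<in> borel_measurable M" for j unfolding u_def[abs_def] by measurable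
  have "(\<lambda>j. (\<integral>\<^sup>+\<omega>. min (ennreal 1) (Z j \<omega>) \<partial>M) + (\<integral>\<^sup>+\<omega>. min (ennreal 1) (Y j \<omega>) \<partial>M)) \<longlonglongrightarrow> 0 + 0"
    by (intro tendsto_add tends_to_0_in_probability_nn_integral_min assms) auto
  then have lim: "(\<lambda>j. \<integral>\<^sup>+\<omega>. u j \<omega> \<partial>M) \<longlonglongrightarrow> 0"
    by (simp add: u_def[abs_def] nn_integral_add)
  \<comment> \<open>The extraction theorem works with integrable real functions; as \<open>u\<close>
    is at most 2, \<open>enn2real\<close> loses no information.\<close>
  have int: "integrable M (\<lambda>\<omega>. enn2real (u j \<omega>))" for j
    by (rule integrable_const_bound[where B=2]) (use u2 in \<open>auto intro!: enn2real_leI\<close>)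
  have "ennreal (\<integral>\<omega>. norm (enn2real (u j \<omega>)) \<partial>M) = (\<integral>\<^sup>+\<omega>. u j \<omega> \<partial>M)" for j
    using nn_integral_eq_integral[OF int[of j]] u_top by (simp add: less_top)
  with lim have "(\<lambda>j. ennreal (\<integral>\<omega>. norm (enn2real (u j \<omega>)) \<partial>M)) \<longlonglongrightarrow> ennreal 0" by simp
  then have "(\<lambda>j. \<integral>\<omega>. norm (enn2real (u j \<omega>)) \<partial>M) \<longlonglongrightarrow> 0"
    by (subst (asm) tendsto_ennreal_iff) auto
  from tendsto_L1_AE_subseq[OF int this] obtain r :: "nat \<Rightarrow> nat" where r: "strict_mono r"
    "AE \<omega> in M. (\<lambda>j. enn2real (u (r j) \<omega>)) \<longlonglongrightarrow> 0" by auto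
  \<comment> \<open>The cap is harmless in the limit, since \<open>min 1 (V j) < min 1 a\<close>
    forces \<open>V j < a\<close>.\<close>
  have conv: "(\<lambda>j. V j) \<longlonglongrightarrow> 0" if "(\<lambda>j. min 1 (V j) :: ennreal) \<longlonglongrightarrow> 0" for V :: "nat \<Rightarrow> ennreal"
  proof (rule order_tendstoI)
    fix a :: ennreal assume "0 < a"
    then have "eventually (\<lambda>j. min 1 (V j) < min 1 a) sequentially"
      using that by (intro order_tendstoD(2)) auto
    then show "eventually (\<lambda>j. V j < a) sequentially" by eventually_elim (auto simp: min_less_iff_disj)
  qed simp
  have "AE \<omega> in M. (\<lambda>j. Z (r j) \<omega>) \<longlonglongrightarrow> 0 \<and> (\<lambda>j. Y (r j) \<omega>) \<longlonglongrightarrow> 0"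
    using r(2)
  proof eventually_elim
    case (elim \<omega>)
    then have "(\<lambda>j. ennreal (enn2real (u (r j) \<omega>))) \<longlonglongrightarrow> ennreal 0" by (intro tendsto_ennrealI)
    then have u0: "(\<lambda>j. u (r j) \<omega>) \<longlonglongrightarrow> 0" using u_top by (simp add: less_top)
    have "(\<lambda>j. min 1 (Z (r j) \<omega>)) \<longlonglongrightarrow> 0" "(\<lambda>j. min 1 (Y (r j) \<omega>)) \<longlonglongrightarrow> 0"
      by (rule tendsto_sandwich[OF _ _ tendsto_const u0]; auto simp: u_def)+
    then show ?case by (auto intro: conv)
  qed
  with r(1) show ?thesis by (rule that)
qed

section \<open>A localized second moment of the Ito integral\<close>

text \<open>The accumulated squares satisfy \<open>q j <= 2 R + 2 Z j\<close>, with
  \<open>Z j\<close> tending to 0 along a subsequence. On the event \<open>R <= c\<close> the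
  integrals truncated at \<open>2 * c + 1\<close> thus eventually coincide with the original ones
  and converge to \<open>I t\<close>. Fatou's lemma then leaves the truncated isometry, whose bound
  \<open>min (2 * c + 1) (q j)\<close> yields the right-hand side.\<close>

lemma ito_integral_localized_second_moment:
  fixes W :: "real \<Rightarrow> 'a \<Rightarrow> real ^ 'd" and \<Phi> :: "real \<Rightarrow> 'a \<Rightarrow> real ^ 'd ^ 'n"
  assumes P: "prob_space M" and F: "usual_filtration M T F" and W: "brownian_motion M T F W"
    and I: "ito_integral M T F W \<Phi> I" and t: "0 \<le> t" "t \<le> T" and c: "0 \<le> c"
    and D: "case_prod D \<in> borel_measurable (M \<Otimes>\<^sub>M lborel)"
    and \<Phi>D: "AE \<omega> in M. \<forall>s\<in>{0..t}. (norm (\<Phi> s \<omega>))\<^sup>2 \<le> D \<omega> s"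
    and R: "R = (\<lambda>\<omega>. \<integral>\<^sup>+s\<in>{0..t}. ennreal (D \<omega> s) \<partial>lborel)"
  shows "(\<integral>\<^sup>+\<omega>. ennreal ((norm (I t \<omega>))\<^sup>2) * indicator {\<omega>. R \<omega> \<le> ennreal c} \<omega> \<partial>M) \<le>
    1 + 2 * (\<integral>\<^sup>+\<omega>. min (ennreal c) (R \<omega>) \<partial>M)"
proof -
  interpret prob_space M by fact
  note [measurable] = D
  have [measurable]: "R \<in> borel_measurable M" unfolding R by measurable
  have D\<omega>: "D \<omega> \<in> borel_measurable borel" if "\<omega> \<in> space M" for \<omega>
    using measurable_compose[OF measurable_Pair1'[OF that] D] by simp
  from I obtain k p H where H: "\<And>j. simple_integrand M T F (k j) (p j) (H j)"
    and Z: "tends_to_0_in_probability M (\<lambda>j \<omega>. \<integral>\<^sup>+s\<in>{0..T}.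
         ennreal ((norm (simple_process (k j) (p j) (H j) s \<omega> - \<Phi> s \<omega>))\<^sup>2) \<partial>lborel)"
    and Y': "\<forall>t\<in>{0..T}. tends_to_0_in_probability M
         (\<lambda>j \<omega>. ennreal (norm (simple_integral W (k j) (p j) (H j) t \<omega> - I t \<omega>)))"
    unfolding ito_integral_def by blast
  have Y: "tends_to_0_in_probability M
         (\<lambda>j \<omega>. ennreal (norm (simple_integral W (k j) (p j) (H j) t \<omega> - I t \<omega>)))"
    using Y' t by simp
  define Z where "Z j \<omega> = (\<integral>\<^sup>+s\<in>{0..T}.
         ennreal ((norm (simple_process (k j) (p j) (H j) s \<omega> - \<Phi> s \<omega>))\<^sup>2) \<partial>lborel)" for j \<omega>
  define q where "q j \<omega> = (\<Sum>i<k j. time_step (p j) t i * (norm (H j i \<omega>))\<^sup>2)" for j \<omega>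
  have Z': "tends_to_0_in_probability M Z" using Z by (simp add: Z_def[abs_def])
  have [measurable]: "Z j \<in> borel_measurable M" for j using Z' by (simp add: tends_to_0_in_probability_def)
  have q0: "0 \<le> q j \<omega>" for j \<omega>
    unfolding q_def using simple_integrand_time_step_nonneg[OF H] by (intro sum_nonneg) auto
  have q_le: "AE \<omega> in M. \<forall>j. ennreal (q j \<omega>) \<le> 2 * R \<omega> + 2 * Z j \<omega>"
    using \<Phi>D AE_space
  proof eventually_elim
    case (elim \<omega>)
    show ?case
    proof
      fix j
      have [measurable]: "(\<lambda>s. simple_process (k j) (p j) (H j) s \<omega>) \<in> borel_measurable borel"
        unfolding simple_process_def by measurable
      have "ennreal (q j \<omega>) = (\<integral>\<^sup>+s\<in>{0..t}. ennreal ((norm (simple_process (k j) (p j) (H j) s \<omega>))\<^sup>2) \<partial>lborel)"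
        unfolding q_def by (rule nn_integral_simple_process[OF H t(1), symmetric])
      also have "\<dots> \<le> 2 * R \<omega> + 2 * (\<integral>\<^sup>+s\<in>{0..t}.
         ennreal ((norm (simple_process (k j) (p j) (H j) s \<omega> - \<Phi> s \<omega>))\<^sup>2) \<partial>lborel)"
        unfolding R using elim D\<omega> by (intro nn_integral_norm_square_le) auto
      also have "\<dots> \<le> 2 * R \<omega> + 2 * Z j \<omega>"
        unfolding Z_def using t by (intro add_left_mono mult_left_mono nn_integral_mono) (auto simp: indicator_def)
      finally show "ennreal (q j \<omega>) \<le> 2 * R \<omega> + 2 * Z j \<omega>" .
    qed
  qed
  have c': "0 \<le> 2 * c + 1" using c by simp
  have "\<forall>j. \<exists>J. J \<in> borel_measurable M \<and>
    (\<forall>\<omega>. q j \<omega> \<le> 2 * c + 1 \<longrightarrow> J \<omega> = simple_integral W (k j) (p j) (H j) t \<omega>) \<and>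
    (\<integral>\<^sup>+\<omega>. ennreal ((norm (J \<omega>))\<^sup>2) \<partial>M) \<le> (\<integral>\<^sup>+\<omega>. ennreal (min (2 * c + 1) (q j \<omega>)) \<partial>M)"
    unfolding q_def by (intro allI, rule simple_integral_truncation[OF P F W H t c']) blast
  from choice[OF this] obtain J where J[measurable]: "\<And>j. J j \<in> borel_measurable M"
    and J_eq: "\<And>j \<omega>. q j \<omega> \<le> 2 * c + 1 \<Longrightarrow> J j \<omega> = simple_integral W (k j) (p j) (H j) t \<omega>"
    and J_le: "\<And>j. (\<integral>\<^sup>+\<omega>. ennreal ((norm (J j \<omega>))\<^sup>2) \<partial>M) \<le> (\<integral>\<^sup>+\<omega>. ennreal (min (2 * c + 1) (q j \<omega>)) \<partial>M)"
    by blast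
  obtain r where r: "strict_mono r"
    and r_lim: "AE \<omega> in M. (\<lambda>j. Z (r j) \<omega>) \<longlonglongrightarrow> 0 \<and>
      (\<lambda>j. ennreal (norm (simple_integral W (k (r j)) (p (r j)) (H (r j)) t \<omega> - I t \<omega>))) \<longlonglongrightarrow> 0"
    by (rule tends_to_0_in_probability_AE_subseq[OF P Z' Y])
  have "AE \<omega> in M. ennreal ((norm (I t \<omega>))\<^sup>2) * indicator {\<omega>. R \<omega> \<le> ennreal c} \<omega> \<le>
      liminf (\<lambda>j. ennreal ((norm (J (r j) \<omega>))\<^sup>2))"
    using r_lim q_le
  proof eventually_elim
    case (elim \<omega>)
    show ?case
    proof (cases "R \<omega> \<le> ennreal c")
      case True
      let ?S = "\<lambda>j. simple_integral W (k (r j)) (p (r j)) (H (r j)) t \<omega>"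
      have "(\<lambda>j. ennreal (norm (?S j - I t \<omega>))) \<longlonglongrightarrow> ennreal 0" using elim by simp
      then have "(\<lambda>j. norm (?S j - I t \<omega>)) \<longlonglongrightarrow> 0" by (subst (asm) tendsto_ennreal_iff) auto
      then have "?S \<longlonglongrightarrow> I t \<omega>" using LIM_zero_iff tendsto_norm_zero_iff by blast
      then have lim: "(\<lambda>j. ennreal ((norm (?S j))\<^sup>2)) \<longlonglongrightarrow> ennreal ((norm (I t \<omega>))\<^sup>2)"
        by (intro tendsto_intros)
      note q_le_\<omega> = elim(2)
      \<comment> \<open>With \<open>Z (r j) \<omega> < 1 / 2\<close> the error adds at most 1 to the
        bound on \<open>q\<close>; this is the 1 in the level \<open>2 * c + 1\<close>.\<close>
      have "(0 :: ennreal) < ennreal (1 / 2)" by (simp only: ennreal_less_zero_iff)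
      from order_tendstoD(2)[OF conjunct1[OF elim(1)] this]
      have "eventually (\<lambda>j. Z (r j) \<omega> < ennreal (1 / 2)) sequentially" .
      then have "eventually (\<lambda>j. ennreal ((norm (?S j))\<^sup>2) = ennreal ((norm (J (r j) \<omega>))\<^sup>2)) sequentially"
      proof eventually_elim
        case (elim j)
        have "ennreal (q (r j) \<omega>) \<le> 2 * R \<omega> + 2 * Z (r j) \<omega>" using q_le_\<omega> by blast
        also have "\<dots> \<le> 2 * ennreal c + 2 * ennreal (1 / 2)"
          using True elim by (intro add_mono mult_left_mono) auto
        also have "\<dots> = ennreal (2 * c) + ennreal (2 * (1 / 2))"
          unfolding ennreal_mult[OF zero_le_numeral c] ennreal_mult[OF zero_le_numeral zero_le_divide_1_iff[THEN iffD2, OF zero_le_numeral]]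
          by (simp only: ennreal_numeral)
        also have "\<dots> = ennreal (2 * c + 1)" using c ennreal_plus[of "2 * c" 1] by simp
        finally have "q (r j) \<omega> \<le> 2 * c + 1" by (simp only: ennreal_le_iff[OF c'])
        then show ?case using J_eq by simp
      qed
      from Lim_transform_eventually[OF lim this]
      have "liminf (\<lambda>j. ennreal ((norm (J (r j) \<omega>))\<^sup>2)) = ennreal ((norm (I t \<omega>))\<^sup>2)"
        by (rule lim_imp_Liminf[OF sequentially_bot])
      then show ?thesis using True by simp
    qed simp
  qed
  then have "(\<integral>\<^sup>+\<omega>. ennreal ((norm (I t \<omega>))\<^sup>2) * indicator {\<omega>. R \<omega> \<le> ennreal c} \<omega> \<partial>M) \<le>
    (\<integral>\<^sup>+\<omega>. liminf (\<lambda>j. ennreal ((norm (J (r j) \<omega>))\<^sup>2)) \<partial>M)"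
    by (rule nn_integral_mono_AE)
  also have "\<dots> \<le> liminf (\<lambda>j. \<integral>\<^sup>+\<omega>. ennreal ((norm (J (r j) \<omega>))\<^sup>2) \<partial>M)"
    by (intro nn_integral_liminf) measurable
  also have "\<dots> \<le> liminf (\<lambda>j. 1 + 2 * (\<integral>\<^sup>+\<omega>. min (ennreal c) (R \<omega>) \<partial>M) +
      2 * (\<integral>\<^sup>+\<omega>. min (ennreal (2 * c + 1)) (Z (r j) \<omega>) \<partial>M))"
  proof (intro Liminf_mono always_eventually allI)
    fix j
    have "(\<integral>\<^sup>+\<omega>. ennreal ((norm (J (r j) \<omega>))\<^sup>2) \<partial>M) \<le> (\<integral>\<^sup>+\<omega>. ennreal (min (2 * c + 1) (q (r j) \<omega>)) \<partial>M)"
      by (rule J_le)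
    also have "\<dots> \<le> (\<integral>\<^sup>+\<omega>. 1 + 2 * min (ennreal c) (R \<omega>) + 2 * min (ennreal (2 * c + 1)) (Z (r j) \<omega>) \<partial>M)"
    proof (rule nn_integral_mono_AE)
      \<comment> \<open>If neither cap on the right is active, the hypothesis on \<open>x\<close>
        suffices. If \<open>a > c\<close>, the first two terms already make \<open>1 + 2 c\<close>;
        if \<open>b > 2 c + 1\<close>, the third term alone is large enough.\<close>
      have *: "ennreal (min (2 * c + 1) x) \<le> 1 + 2 * min (ennreal c) a + 2 * min (ennreal (2 * c + 1)) b"
        if x: "ennreal x \<le> 2 * a + 2 * b" for x a b
      proof (cases "a \<le> ennreal c \<and> b \<le> ennreal (2 * c + 1)")
        case True
        have "ennreal (min (2 * c + 1) x) \<le> ennreal x" by (intro ennreal_leI) simp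
        also note x
        also have "2 * a + 2 * b \<le> 1 + 2 * a + 2 * b" by (simp add: add.assoc)
        finally show ?thesis using True by (simp add: min_absorb2)
      next
        case False
        have "ennreal (min (2 * c + 1) x) \<le> ennreal (2 * c + 1)" by (intro ennreal_leI) simp
        moreover have "ennreal (2 * c + 1) = 1 + 2 * ennreal c"
          using c by (simp add: ennreal_plus ennreal_mult add.commute)
        moreover have "1 + 2 * ennreal c \<le> 1 + 2 * min (ennreal c) a + 2 * min (ennreal (2 * c + 1)) b" if "\<not> a \<le> ennreal c"
          using that by (simp add: min_absorb1)
        moreover have "ennreal (2 * c + 1) \<le> 1 + 2 * min (ennreal c) a + 2 * min (ennreal (2 * c + 1)) b" if "\<not> b \<le> ennreal (2 * c + 1)"
        proof -
          have "ennreal (2 * c + 1) \<le> 2 * ennreal (2 * c + 1)"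
            using mult_right_mono[of 1 2 "ennreal (2 * c + 1)"] by simp
          also have "\<dots> = 2 * min (ennreal (2 * c + 1)) b" using that by (simp add: min_absorb1)
          finally show ?thesis by (rule add_increasing[rotated]) simp
        qed
        ultimately show ?thesis using False by (auto intro: order_trans)
      qed
      show "AE \<omega> in M. ennreal (min (2 * c + 1) (q (r j) \<omega>)) \<le>
         1 + 2 * min (ennreal c) (R \<omega>) + 2 * min (ennreal (2 * c + 1)) (Z (r j) \<omega>)"
        using q_le by eventually_elim (intro *, auto)
    qed
    also have "\<dots> = 1 + 2 * (\<integral>\<^sup>+\<omega>. min (ennreal c) (R \<omega>) \<partial>M) +
      2 * (\<integral>\<^sup>+\<omega>. min (ennreal (2 * c + 1)) (Z (r j) \<omega>) \<partial>M)"
      by (simp add: nn_integral_add nn_integral_cmult emeasure_space_1)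
    finally show "(\<integral>\<^sup>+\<omega>. ennreal ((norm (J (r j) \<omega>))\<^sup>2) \<partial>M) \<le> \<dots>" .
  qed
  \<comment> \<open>The error is capped, so convergence in probability makes its expectation vanish,
    also along the subsequence.\<close>
  also have "\<dots> = 1 + 2 * (\<integral>\<^sup>+\<omega>. min (ennreal c) (R \<omega>) \<partial>M) + 2 * 0"
  proof (intro lim_imp_Liminf tendsto_add tendsto_const)
    have "(\<lambda>j. \<integral>\<^sup>+\<omega>. min (ennreal (2 * c + 1)) (Z j \<omega>) \<partial>M) \<longlonglongrightarrow> 0"
      by (rule tends_to_0_in_probability_nn_integral_min[OF P Z' c'])
    from LIMSEQ_subseq_LIMSEQ[OF this r]
    have "(\<lambda>j. \<integral>\<^sup>+\<omega>. min (ennreal (2 * c + 1)) (Z (r j) \<omega>) \<partial>M) \<longlonglongrightarrow> 0" by (simp add: o_def)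
    then show "(\<lambda>j. 2 * (\<integral>\<^sup>+\<omega>. min (ennreal (2 * c + 1)) (Z (r j) \<omega>) \<partial>M)) \<longlonglongrightarrow> 2 * 0"
      by (intro ennreal_tendsto_cmult) auto
  qed simp
  finally show ?thesis by simp
qed

section \<open>Second moments of strong solutions\<close>

text \<open>In the supremum norm with weight \<open>exp (- 2 * b * s)\<close>, integrating from 0
  and multiplying by \<open>b\<close> contracts by the factor 1/2, so \<open>S <= a + S / 2\<close>.
  The bound \<open>m\<close> makes \<open>S\<close> finite, so that this can be solved for
  \<open>S\<close>; the result is uniform in \<open>m\<close>.\<close>

lemma gronwall_ennreal:
  fixes w :: "real \<Rightarrow> ennreal"
  assumes b: "0 < b" and m: "m < \<top>" "\<And>t. t \<in> {0..T} \<Longrightarrow> w t \<le> m"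
    and w: "\<And>t. t \<in> {0..T} \<Longrightarrow> w t \<le> ennreal a + ennreal b * (\<integral>\<^sup>+s\<in>{0..t}. w s \<partial>lborel)"
    and t: "t \<in> {0..T}" and a: "0 \<le> a"
  shows "w t \<le> ennreal (2 * a * exp (2 * b * t))"
proof -
  define S where "S = (SUP s\<in>{0..T}. w s * ennreal (exp (- 2 * b * s)))"
  have "w s * ennreal (exp (- 2 * b * s)) \<le> m" if "s \<in> {0..T}" for s
  proof -
    have "ennreal (exp (- 2 * b * s)) \<le> 1" using that b by (simp add: ennreal_le_1)
    then show ?thesis using mult_mono[OF m(2)[OF that], of _ 1] by simp
  qed
  then have "S \<le> m" unfolding S_def by (rule SUP_least)
  then obtain S' where S': "S = ennreal S'" "0 \<le> S'" using m(1) by (cases S) auto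
  have w_le: "w s \<le> ennreal (S' * exp (2 * b * s))" if "s \<in> {0..T}" for s
  proof -
    have "w s = w s * ennreal (exp (- 2 * b * s)) * ennreal (exp (2 * b * s))"
      by (simp add: mult.assoc flip: ennreal_mult exp_add)
    also have "\<dots> \<le> S * ennreal (exp (2 * b * s))"
      unfolding S_def using that by (intro mult_right_mono SUP_upper) auto
    finally show ?thesis using S' by (simp add: ennreal_mult)
  qed
  have step: "w s * ennreal (exp (- 2 * b * s)) \<le> ennreal (a + S' / 2)" if s: "s \<in> {0..T}" for s
  proof -
    have "(\<integral>\<^sup>+u\<in>{0..s}. w u \<partial>lborel) \<le> (\<integral>\<^sup>+u. ennreal (S' * exp (2 * b * u)) * indicator {0..s} u \<partial>lborel)"
      using w_le s by (intro nn_integral_mono) (auto simp: indicator_def)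
    \<comment> \<open>The primitive divides by \<open>2 * b\<close>; multiplied by \<open>b\<close>
      this leaves the contraction factor 1/2.\<close>
    also have "\<dots> = ennreal (S' * exp (2 * b * s) / (2 * b) - S' * exp (2 * b * 0) / (2 * b))"
      using b s S' by (intro nn_integral_FTC_Icc) (auto intro!: derivative_eq_intros)
    also have "\<dots> \<le> ennreal (S' * exp (2 * b * s) / (2 * b))" using b S' by (intro ennreal_leI) simp
    finally have "w s \<le> ennreal a + ennreal b * ennreal (S' * exp (2 * b * s) / (2 * b))"
      using w[OF s] by (meson add_left_mono mult_left_mono order_trans zero_le)
    also have "\<dots> = ennreal (a + S' / 2 * exp (2 * b * s))"
      using a b S' by (simp add: ennreal_plus flip: ennreal_mult)
    finally have "w s * ennreal (exp (- 2 * b * s)) \<le> ennreal (a + S' / 2 * exp (2 * b * s)) * ennreal (exp (- 2 * b * s))"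
      by (rule mult_right_mono) simp
    also have "\<dots> = ennreal (a * exp (- 2 * b * s) + S' / 2 * (exp (2 * b * s) * exp (- 2 * b * s)))"
      using a S' by (simp add: algebra_simps flip: ennreal_mult)
    also have "\<dots> \<le> ennreal (a + S' / 2)"
      using mult_left_mono[of "exp (- 2 * b * s)" 1 a] a b s by (intro ennreal_leI) (simp flip: exp_add)
    finally show ?thesis .
  qed
  have "S \<le> ennreal (a + S' / 2)" unfolding S_def using step by (rule SUP_least)
  then have "S' \<le> a + S' / 2" using S' a by (simp only: ennreal_le_iff)
  then have "S' \<le> 2 * a" by simp
  then have "S' * exp (2 * b * t) \<le> 2 * a * exp (2 * b * t)" by (intro mult_right_mono) auto
  then show ?thesis using w_le[OF t] by (meson ennreal_leI order_trans)
qed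

text \<open>If the integral up to \<open>t\<close> stays below \<open>c\<close>, the indicator is 1
  throughout. Otherwise the integral attains \<open>c\<close> at some time \<open>s\<close> by
  continuity, and the part up to \<open>s\<close> already contributes \<open>c\<close>. This is the
  substitute for stopping at the hitting time of \<open>c\<close>.\<close>

lemma min_nn_integral_le_nn_integral_stopped:
  fixes D :: "real \<Rightarrow> real"
  assumes D: "continuous_on UNIV D" "\<And>s. 0 \<le> D s" and t: "0 \<le> t" and c: "0 \<le> c"
  shows "min (ennreal c) (\<integral>\<^sup>+u\<in>{0..t}. ennreal (D u) \<partial>lborel) \<le>
    (\<integral>\<^sup>+s\<in>{0..t}. ennreal (D s) * indicator {s. (\<integral>\<^sup>+u\<in>{0..s}. ennreal (D u) \<partial>lborel) \<le> ennreal c} s \<partial>lborel)"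
proof -
  define r where "r s = (\<integral>\<^sup>+u\<in>{0..s}. ennreal (D u) \<partial>lborel)" for s
  \<comment> \<open>A real-valued continuous version of \<open>r\<close> for nonnegative times, to
    which the intermediate value theorem applies.\<close>
  define \<rho> where "\<rho> s = integral {0..s} D" for s
  have cont: "continuous_on {0..s} D" for s using D(1) continuous_on_subset by blast
  have r_eq: "r s = ennreal (\<rho> s)" if "0 \<le> s" for s
  proof -
    have "set_integrable lborel {0..s} D" by (rule borel_integrable_atLeastAtMost'[OF cont])
    moreover have "r s = (\<integral>\<^sup>+u. ennreal (indicator {0..s} u *\<^sub>R D u) \<partial>lborel)"
      unfolding r_def by (intro nn_integral_cong) (auto simp: indicator_def)
    ultimately have "r s = ennreal (\<integral>u. indicator {0..s} u *\<^sub>R D u \<partial>lborel)"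
      using D(2) by (simp add: nn_integral_eq_integral set_integrable_def)
    then show ?thesis
      using set_borel_integral_eq_integral(2)[OF \<open>set_integrable lborel {0..s} D\<close>]
      by (simp add: \<rho>_def set_lebesgue_integral_def)
  qed
  have r_mono: "r s \<le> r s'" if "s \<le> s'" for s s'
    unfolding r_def using that by (intro nn_integral_mono) (auto simp: indicator_def)
  show ?thesis
  proof (cases "r t \<le> ennreal c")
    case True
    have "r t \<le> (\<integral>\<^sup>+s\<in>{0..t}. ennreal (D s) * indicator {s. r s \<le> ennreal c} s \<partial>lborel)"
      unfolding r_def[of t]
    proof (rule nn_integral_mono)
      fix s
      show "ennreal (D s) * indicator {0..t} s \<le> ennreal (D s) * indicator {s. r s \<le> ennreal c} s * indicator {0..t} s"
        using order_trans[OF r_mono True, of s] by (auto simp: indicator_def)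
    qed
    then show ?thesis unfolding r_def by (rule min.coboundedI2)
  next
    case False
    have "\<exists>s. 0 \<le> s \<and> s \<le> t \<and> \<rho> s = c"
    proof (rule IVT')
      show "\<rho> 0 \<le> c" using c by (simp add: \<rho>_def)
      show "c \<le> \<rho> t" using False t c by (simp add: r_eq ennreal_le_iff2)
      show "continuous_on {0..t} \<rho>" unfolding \<rho>_def[abs_def]
        by (intro indefinite_integral_continuous_1 integrable_continuous_real cont)
    qed (rule t)
    then obtain s where s: "0 \<le> s" "s \<le> t" "\<rho> s = c" by blast
    \<comment> \<open>\<open>r\<close> is nondecreasing, hence at most \<open>c\<close> up to time
      \<open>s\<close>, so the indicator removes nothing there.\<close>
    have "ennreal c = r s" using s r_eq by simp
    also have "r s \<le> (\<integral>\<^sup>+s\<in>{0..t}. ennreal (D s) * indicator {s. r s \<le> ennreal c} s \<partial>lborel)"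
      unfolding r_def[of s]
    proof (rule nn_integral_mono)
      fix u
      show "ennreal (D u) * indicator {0..s} u \<le> ennreal (D u) * indicator {s. r s \<le> ennreal c} u * indicator {0..t} u"
        using r_mono[of u s] s r_eq[of s] by (auto simp: indicator_def)
    qed
    finally show ?thesis unfolding r_def by (rule min.coboundedI1)
  qed
qed

text \<open>Cauchy-Schwarz against the indicator of \<open>{0..t}\<close>, whose square integrates
  to \<open>t\<close>.\<close>

lemma norm_set_integral_square_le:
  fixes b :: "real \<Rightarrow> 'b::euclidean_space"
  assumes b: "set_integrable lborel {0..t} b" and D: "\<And>s. s \<in> {0..t} \<Longrightarrow> (norm (b s))\<^sup>2 \<le> D s" and t: "0 \<le> t"
  shows "ennreal ((norm (LINT s:{0..t}|lborel. b s))\<^sup>2) \<le> ennreal t * (\<integral>\<^sup>+s\<in>{0..t}. ennreal (D s) \<partial>lborel)"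
proof -
  let ?b = "\<lambda>s. indicator {0..t} s *\<^sub>R b s"
  have int: "integrable lborel ?b" using b by (simp add: set_integrable_def)
  then have [measurable]: "?b \<in> borel_measurable lborel" by auto
  have "ennreal (norm (LINT s:{0..t}|lborel. b s)) \<le> (\<integral>\<^sup>+s. ennreal (norm (?b s)) \<partial>lborel)"
    unfolding set_lebesgue_integral_def by (rule integral_norm_bound_ennreal[OF int])
  also have "\<dots> = (\<integral>\<^sup>+s. ennreal (norm (?b s)) * indicator {0..t} s \<partial>lborel)"
    by (intro nn_integral_cong) (auto simp: indicator_def)
  finally have "ennreal ((norm (LINT s:{0..t}|lborel. b s))\<^sup>2) \<le> (\<integral>\<^sup>+s. ennreal (norm (?b s)) * indicator {0..t} s \<partial>lborel)\<^sup>2"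
    by (subst ennreal_power[symmetric]) (auto intro!: power_mono)
  also have "\<dots> \<le> (\<integral>\<^sup>+s. (ennreal (norm (?b s)))\<^sup>2 \<partial>lborel) * (\<integral>\<^sup>+s. (indicator {0..t} s)\<^sup>2 \<partial>lborel)"
    by (rule Cauchy_Schwarz_nn_integral) measurable
  also have "(\<integral>\<^sup>+s. (indicator {0..t} s :: ennreal)\<^sup>2 \<partial>lborel) = (\<integral>\<^sup>+s. indicator {0..t} s \<partial>lborel)"
    by (intro nn_integral_cong) (auto simp: indicator_def)
  also have "\<dots> = ennreal t" using t by simp
  also have "(\<integral>\<^sup>+s. (ennreal (norm (?b s)))\<^sup>2 \<partial>lborel) \<le> (\<integral>\<^sup>+s\<in>{0..t}. ennreal (D s) \<partial>lborel)"
    using D by (intro nn_integral_mono) (auto simp: indicator_def ennreal_power intro!: ennreal_leI)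
  finally show ?thesis by (simp add: mult.commute mult_right_mono)
qed

text \<open>Rounding time down to a grid of mesh \<open>1 / Suc n\<close> leaves countably many time
  sections, which gives joint measurability; continuity of the paths makes these approximations
  converge pointwise.\<close>

lemma borel_measurable_pair_continuous:
  fixes f :: "'a \<Rightarrow> real \<Rightarrow> 'b::euclidean_space"
  assumes f: "\<And>s. (\<lambda>\<omega>. f \<omega> s) \<in> borel_measurable M"
    and cont: "\<And>\<omega>. \<omega> \<in> space M \<Longrightarrow> continuous_on UNIV (f \<omega>)"
  shows "case_prod f \<in> borel_measurable (M \<Otimes>\<^sub>M lborel)"
proof (rule borel_measurable_LIMSEQ_metric)
  let ?g = "\<lambda>n s. real_of_int \<lfloor>real (Suc n) * s\<rfloor> / real (Suc n)"
  show "(\<lambda>(\<omega>, s). f \<omega> (?g n s)) \<in> borel_measurable (M \<Otimes>\<^sub>M lborel)" for n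
    unfolding split_beta'
    by (rule measurable_compose_countable[where f="\<lambda>i x. f (fst x) (real_of_int i / real (Suc n))"
          and g="\<lambda>x. \<lfloor>real (Suc n) * snd x\<rfloor>"])
      (use f in measurable)
  fix x assume "x \<in> space (M \<Otimes>\<^sub>M (lborel :: real measure))"
  then obtain \<omega> s where x: "x = (\<omega>, s)" "\<omega> \<in> space M" by (auto simp: space_pair_measure)
  have "(\<lambda>n. ?g n s) \<longlonglongrightarrow> s"
  proof (rule tendsto_sandwich)
    show "(\<lambda>n. s - 1 / real (Suc n)) \<longlonglongrightarrow> s"
      using tendsto_diff[OF tendsto_const LIMSEQ_Suc[OF lim_1_over_n]] by simp
    show "eventually (\<lambda>n. s - 1 / real (Suc n) \<le> ?g n s) sequentially"
    proof (intro always_eventually allI)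
      fix n
      have "real (Suc n) * s - 1 \<le> real_of_int \<lfloor>real (Suc n) * s\<rfloor>" by linarith
      then have "(real (Suc n) * s - 1) / real (Suc n) \<le> ?g n s" by (rule divide_right_mono) simp
      then show "s - 1 / real (Suc n) \<le> ?g n s" by (simp add: diff_divide_distrib del: of_nat_Suc)
    qed
    show "eventually (\<lambda>n. ?g n s \<le> s) sequentially"
    proof (intro always_eventually allI)
      fix n
      have "?g n s \<le> real (Suc n) * s / real (Suc n)" by (rule divide_right_mono) auto
      then show "?g n s \<le> s" by (simp del: of_nat_Suc)
    qed
  qed simp
  then have "(\<lambda>n. f \<omega> (?g n s)) \<longlonglongrightarrow> f \<omega> s"
    by (rule continuous_on_tendsto_compose[OF cont[OF x(2)]]) auto
  then show "(\<lambda>n. case x of (\<omega>, s) \<Rightarrow> f \<omega> (?g n s)) \<longlonglongrightarrow> case_prod f x" by (simp add: x)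
qed

text \<open>Joint measurability calls for continuity of every path on the whole line, while
  \<open>X\<close> is continuous only almost surely and only on \<open>{0..T}\<close>. Paths are set
  to 0 on a null set and continued constantly outside the horizon.\<close>

lemma continuous_modification:
  fixes X :: "real \<Rightarrow> 'a \<Rightarrow> 'b::euclidean_space"
  assumes T: "0 \<le> T" and X: "\<And>t. t \<in> {0..T} \<Longrightarrow> X t \<in> borel_measurable M"
    and cont: "continuous_paths M T X"
  obtains Y where "\<And>s. (\<lambda>\<omega>. Y \<omega> s) \<in> borel_measurable M"
    "\<And>\<omega>. \<omega> \<in> space M \<Longrightarrow> continuous_on UNIV (Y \<omega>)"
    "AE \<omega> in M. \<forall>t\<in>{0..T}. Y \<omega> t = X t \<omega>"
proof -
  \<comment> \<open>The set of discontinuous paths is not assumed measurable; \<open>N\<close> is a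
    measurable null cover of it.\<close>
  obtain N where N: "{\<omega> \<in> space M. \<not> continuous_on {0..T} (\<lambda>t. X t \<omega>)} \<subseteq> N" "N \<in> null_sets M"
    using cont unfolding continuous_paths_def by (auto elim!: AE_E simp: null_sets_def)
  then have [measurable]: "N \<in> sets M" by auto
  define cl where "cl s = max 0 (min T s)" for s
  define Y where "Y \<omega> s = (if \<omega> \<in> N then 0 else X (cl s) \<omega>)" for \<omega> s
  have cl: "cl s \<in> {0..T}" for s using T by (auto simp: cl_def)
  show ?thesis
  proof
    show "(\<lambda>\<omega>. Y \<omega> s) \<in> borel_measurable M" for s
      using X[OF cl[of s]] unfolding Y_def by measurable
    show "continuous_on UNIV (Y \<omega>)" if "\<omega> \<in> space M" for \<omega>
    proof (cases "\<omega> \<in> N")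
      case False
      then have "continuous_on {0..T} (\<lambda>t. X t \<omega>)" using N that by auto
      moreover have "continuous_on UNIV cl" unfolding cl_def by (intro continuous_intros)
      ultimately have "continuous_on UNIV (\<lambda>s. X (cl s) \<omega>)"
        using cl by (intro continuous_on_compose2[of "{0..T}" "\<lambda>t. X t \<omega>" UNIV cl]) auto
      then show ?thesis using False by (simp add: Y_def[abs_def])
    qed (simp add: Y_def[abs_def])
    show "AE \<omega> in M. \<forall>t\<in>{0..T}. Y \<omega> t = X t \<omega>"
      using AE_not_in[OF N(2)] by eventually_elim (auto simp: Y_def cl_def max_def min_def)
  qed
qed

section \<open>Growth bounds and the moment estimate\<close>

lemma norm_add3_square_le:
  fixes a b c :: "'a::real_normed_vector"
  shows "(norm (a + b + c))\<^sup>2 \<le> 3 * (norm a)\<^sup>2 + 3 * (norm b)\<^sup>2 + 3 * (norm c)\<^sup>2"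
proof -
  have "norm (a + b + c) \<le> norm a + norm b + norm c"
    by (meson norm_triangle_ineq order_trans add_right_mono)
  then have "(norm (a + b + c))\<^sup>2 \<le> (norm a + norm b + norm c)\<^sup>2" by (intro power_mono) auto
  also have "\<dots> \<le> 3 * (norm a)\<^sup>2 + 3 * (norm b)\<^sup>2 + 3 * (norm c)\<^sup>2"
    using sum_squares_bound[of "norm a" "norm b"] sum_squares_bound[of "norm a" "norm c"]
      sum_squares_bound[of "norm b" "norm c"] by (simp add: power2_eq_square algebra_simps)
  finally show ?thesis .
qed

lemma power2_le_linear_growth:
  fixes k x z :: real
  assumes "0 \<le> z" "z \<le> k * (1 + x)" "0 \<le> x" "0 \<le> k"
  shows "z\<^sup>2 \<le> 2 * k\<^sup>2 * (1 + x\<^sup>2)"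
proof -
  have "z\<^sup>2 \<le> (k * (1 + x))\<^sup>2" using assms by (intro power_mono) auto
  also have "\<dots> = k\<^sup>2 * (1 + x)\<^sup>2" by (simp add: power_mult_distrib)
  also have "\<dots> \<le> k\<^sup>2 * (2 * (1 + x\<^sup>2))"
    using sum_squares_bound[of 1 x] by (intro mult_left_mono) (auto simp: power2_sum)
  finally show ?thesis by (simp add: algebra_simps)
qed

lemma strong_solution_second_moment:
  fixes M :: "'a measure" and W :: "real \<Rightarrow> 'a \<Rightarrow> real ^ 'd"
    and \<mu> :: "real ^ 'n \<Rightarrow> 'k::euclidean_space \<Rightarrow> real ^ 'n"
    and \<sigma> :: "real ^ 'n \<Rightarrow> 'k \<Rightarrow> real ^ 'd ^ 'n"
  assumes P: "prob_space M" and F: "usual_filtration M T F" and W: "brownian_motion M T F W"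
    and T: "0 < T" and k: "0 < k"
    and growth: "\<And>x a. a \<in> \<AA> \<Longrightarrow> norm (\<mu> x a) \<le> k * (1 + norm x) \<and> norm (\<sigma> x a) \<le> k * (1 + norm x)"
    and A: "A \<in> admissible_controls M T F \<AA>"
    and X: "strong_solution M T F W \<mu> \<sigma> x0 A X"
  shows "integrable M (\<lambda>\<omega>. (norm (X T \<omega>))\<^sup>2)"
proof -
  interpret prob_space M by fact
  interpret pair_sigma_finite M "lborel :: real measure" ..
  \<comment> \<open>The constant of \<open>power2_le_linear_growth\<close>, so that \<open>D\<close>
    below dominates the squares of both coefficients along almost every path.\<close>
  define \<kappa> where "\<kappa> = 2 * k\<^sup>2"
  have \<kappa>: "0 < \<kappa>" using k by (simp add: \<kappa>_def)
  have sub: "subalgebra M (F s)" if "s \<in> {0..T}" for s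
    using F that by (auto simp: usual_filtration_def)
  have XM: "X t \<in> borel_measurable M" if "t \<in> {0..T}" for t
    using X that measurable_from_subalg[OF sub[OF that]] unfolding strong_solution_def adapted_def by blast
  \<comment> \<open>\<open>Y\<close> stands in for \<open>X\<close> where joint measurability in
    time and outcome is needed, in particular for Fubini.\<close>
  obtain Y where Y: "\<And>s. (\<lambda>\<omega>. Y \<omega> s) \<in> borel_measurable M"
    and Y_cont: "\<And>\<omega>. \<omega> \<in> space M \<Longrightarrow> continuous_on UNIV (Y \<omega>)"
    and Y_X: "AE \<omega> in M. \<forall>t\<in>{0..T}. Y \<omega> t = X t \<omega>"
  proof (rule continuous_modification[OF less_imp_le[OF T] XM])
    show "continuous_paths M T X" using X unfolding strong_solution_def by blast
  qed blast+
  note [measurable] = Y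
  have [measurable]: "case_prod Y \<in> borel_measurable (M \<Otimes>\<^sub>M lborel)"
    by (rule borel_measurable_pair_continuous[OF Y Y_cont])
  define D where "D \<omega> s = \<kappa> * (1 + (norm (Y \<omega> s))\<^sup>2)" for \<omega> s
  have D_meas[measurable]: "case_prod D \<in> borel_measurable (M \<Otimes>\<^sub>M lborel)"
    unfolding D_def split_beta' by measurable
  have D_cont: "continuous_on UNIV (D \<omega>)" if "\<omega> \<in> space M" for \<omega>
    unfolding D_def[abs_def] using Y_cont[OF that] by (intro continuous_intros)
  have D0: "0 \<le> D \<omega> s" for \<omega> s using \<kappa> by (simp add: D_def)
  define R where "R t \<omega> = (\<integral>\<^sup>+s\<in>{0..t}. ennreal (D \<omega> s) \<partial>lborel)" for t \<omega>
  have R_meas[measurable]: "R t \<in> borel_measurable M" for t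
    unfolding R_def[abs_def] by measurable
  have R_pair[measurable]: "(\<lambda>x. R (snd x) (fst x)) \<in> borel_measurable (M \<Otimes>\<^sub>M lborel)"
  proof -
    \<comment> \<open>The moving endpoint is encoded as a fixed measurable set of pairs of times,
      which makes this a parameter integral of a jointly measurable function.\<close>
    have "(\<lambda>x. R (snd x) (fst x)) = (\<lambda>x. \<integral>\<^sup>+s. ennreal (D (fst x) s) * indicator {(u, v). 0 \<le> u \<and> u \<le> v} (s, snd x) \<partial>lborel)"
      unfolding R_def by (intro ext nn_integral_cong) (auto simp: indicator_def)
    also have "\<dots> \<in> borel_measurable (M \<Otimes>\<^sub>M lborel)" by measurable
    finally show ?thesis .
  qed
  have DX: "AE \<omega> in M. \<forall>s\<in>{0..T}. (norm (\<mu> (X s \<omega>) (A s \<omega>)))\<^sup>2 \<le> D \<omega> s \<and> (norm (\<sigma> (X s \<omega>) (A s \<omega>)))\<^sup>2 \<le> D \<omega> s"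
  proof -
    have "AE \<omega> in M. \<forall>t\<in>{0..T}. A t \<omega> \<in> \<AA>" using A by (simp add: admissible_controls_def)
    with Y_X show ?thesis
    proof eventually_elim
      case (elim \<omega>)
      then show ?case using growth k by (auto simp: D_def \<kappa>_def intro!: power2_le_linear_growth)
    qed
  qed
  from X obtain I where I: "ito_integral M T F W (\<lambda>s \<omega>. \<sigma> (X s \<omega>) (A s \<omega>)) I"
    and X_eq: "AE \<omega> in M. \<forall>t\<in>{0..T}. X t \<omega> = x0 + (LINT s:{0..t}|lborel. \<mu> (X s \<omega>) (A s \<omega>)) + I t \<omega>"
    and \<mu>_int: "AE \<omega> in M. set_integrable lborel {0..T} (\<lambda>s. \<mu> (X s \<omega>) (A s \<omega>))"
    unfolding strong_solution_def by blast
  \<comment> \<open>Separating the three terms of the equation costs a factor 3, and Cauchy-Schwarz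
    bounds the squared drift integral by \<open>T\<close> times \<open>R t\<close>.\<close>
  have X_le: "AE \<omega> in M. \<forall>t\<in>{0..T}. ennreal ((norm (Y \<omega> t))\<^sup>2) \<le>
      ennreal (3 * (norm x0)\<^sup>2) + ennreal (3 * T) * R t \<omega> + 3 * ennreal ((norm (I t \<omega>))\<^sup>2)"
    using X_eq \<mu>_int DX Y_X
  proof eventually_elim
    case (elim \<omega>)
    show ?case
    proof
      fix t assume t: "t \<in> {0..T}"
      let ?b = "LINT s:{0..t}|lborel. \<mu> (X s \<omega>) (A s \<omega>)"
      have "set_integrable lborel {0..t} (\<lambda>s. \<mu> (X s \<omega>) (A s \<omega>))"
        using elim(2) by (rule set_integrable_subset) (use t in auto)
      then have "ennreal ((norm ?b)\<^sup>2) \<le> ennreal t * R t \<omega>"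
        unfolding R_def using elim(3) t by (intro norm_set_integral_square_le) auto
      also have "\<dots> \<le> ennreal T * R t \<omega>" using t by (intro mult_right_mono ennreal_leI) auto
      finally have b: "3 * ennreal ((norm ?b)\<^sup>2) \<le> ennreal (3 * T) * R t \<omega>"
        using T by (simp add: ennreal_mult mult.assoc mult_left_mono)
      have "Y \<omega> t = x0 + ?b + I t \<omega>" using elim(1,4) t by auto
      then have "ennreal ((norm (Y \<omega> t))\<^sup>2) \<le>
          ennreal (3 * (norm x0)\<^sup>2 + 3 * (norm ?b)\<^sup>2 + 3 * (norm (I t \<omega>))\<^sup>2)"
        using norm_add3_square_le by (intro ennreal_leI) simp
      also have "\<dots> = ennreal (3 * (norm x0)\<^sup>2) + 3 * ennreal ((norm ?b)\<^sup>2) + 3 * ennreal ((norm (I t \<omega>))\<^sup>2)"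
        by (simp add: ennreal_plus ennreal_mult)
      finally show "ennreal ((norm (Y \<omega> t))\<^sup>2) \<le> ennreal (3 * (norm x0)\<^sup>2) + ennreal (3 * T) * R t \<omega> + 3 * ennreal ((norm (I t \<omega>))\<^sup>2)"
        using b by (meson add_left_mono add_right_mono order_trans)
    qed
  qed
  \<comment> \<open>The summand 3 here and the 6 in \<open>\<beta>\<close> are three times the
    constants 1 and 2 of the localized Ito bound; \<open>3 * T\<close> comes from the drift.\<close>
  define \<alpha> where "\<alpha> = 3 * (norm x0)\<^sup>2 + 3"
  define \<beta> where "\<beta> = 3 * T + 6"
  have \<alpha>\<beta>: "0 \<le> \<alpha>" "0 < \<beta>" using T by (simp_all add: \<alpha>_def \<beta>_def add_pos_pos)
  \<comment> \<open>Uniformity in \<open>c\<close> is what permits exhausting the space by the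
    events \<open>R T <= c\<close> afterwards.\<close>
  have moment: "(\<integral>\<^sup>+\<omega>. ennreal ((norm (Y \<omega> T))\<^sup>2) * indicator {\<omega>. R T \<omega> \<le> ennreal c} \<omega> \<partial>M) \<le>
      ennreal (2 * (\<alpha> + \<beta> * \<kappa> * T) * exp (2 * (\<beta> * \<kappa>) * T))" if c: "0 \<le> c" for c
  proof -
    define w where "w t = (\<integral>\<^sup>+\<omega>. ennreal ((norm (Y \<omega> t))\<^sup>2) * indicator {\<omega>. R t \<omega> \<le> ennreal c} \<omega> \<partial>M)" for t
    define m where "m t = (\<integral>\<^sup>+\<omega>. min (ennreal c) (R t \<omega>) \<partial>M)" for t
    have w_le_m: "w t \<le> ennreal \<alpha> + ennreal \<beta> * m t" if t: "t \<in> {0..T}" for t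
    proof -
      let ?G = "indicator {\<omega>. R t \<omega> \<le> ennreal c} :: 'a \<Rightarrow> ennreal"
      have [measurable]: "I t \<in> borel_measurable M"
        using I t measurable_from_subalg[OF sub[OF t]] unfolding ito_integral_def adapted_def by blast
      \<comment> \<open>On the event \<open>R t <= c\<close> the capped value
        \<open>min c (R t)\<close> is \<open>R t\<close> itself, so the drift term keeps its bound;
        off this event the integrand of \<open>w t\<close> is 0.\<close>
      have "w t \<le> (\<integral>\<^sup>+\<omega>. ennreal (3 * (norm x0)\<^sup>2) + ennreal (3 * T) * min (ennreal c) (R t \<omega>) +
          3 * (ennreal ((norm (I t \<omega>))\<^sup>2) * ?G \<omega>) \<partial>M)"
        unfolding w_def
      proof (rule nn_integral_mono_AE)
        show "AE \<omega> in M. ennreal ((norm (Y \<omega> t))\<^sup>2) * ?G \<omega> \<le> ennreal (3 * (norm x0)\<^sup>2) +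
          ennreal (3 * T) * min (ennreal c) (R t \<omega>) + 3 * (ennreal ((norm (I t \<omega>))\<^sup>2) * ?G \<omega>)"
          using X_le by eventually_elim (use t in \<open>auto simp: indicator_def min_absorb2\<close>)
      qed
      also have "\<dots> = ennreal (3 * (norm x0)\<^sup>2) + ennreal (3 * T) * m t +
          3 * (\<integral>\<^sup>+\<omega>. ennreal ((norm (I t \<omega>))\<^sup>2) * ?G \<omega> \<partial>M)"
        by (simp add: nn_integral_add nn_integral_cmult emeasure_space_1 m_def)
      also have "\<dots> \<le> ennreal (3 * (norm x0)\<^sup>2) + ennreal (3 * T) * m t + 3 * (1 + 2 * m t)"
        unfolding m_def
      proof (intro add_left_mono mult_left_mono ito_integral_localized_second_moment[OF P F W I _ _ c D_meas])
        show "AE \<omega> in M. \<forall>s\<in>{0..t}. (norm (\<sigma> (X s \<omega>) (A s \<omega>)))\<^sup>2 \<le> D \<omega> s"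
          using DX by eventually_elim (use t in auto)
      qed (use t in \<open>auto simp: R_def\<close>)
      also have "\<dots> = ennreal \<alpha> + ennreal \<beta> * m t"
      proof -
        have "3 * (1 + 2 * x) = 3 + 6 * x" for x :: ennreal
          by (simp add: distrib_left flip: mult.assoc)
        then show ?thesis
          using T by (simp add: \<alpha>_def \<beta>_def ennreal_plus distrib_right add_ac)
      qed
      finally show ?thesis .
    qed
    \<comment> \<open>This crude bound provides the a priori finiteness that the Gronwall lemma asks
      for.\<close>
    have m_c: "m t \<le> ennreal c" for t
    proof -
      have "m t \<le> (\<integral>\<^sup>+\<omega>. ennreal c \<partial>M)" unfolding m_def by (intro nn_integral_mono) simp
      then show ?thesis by (simp add: emeasure_space_1)
    qed
    \<comment> \<open>The stopped integral dominates the capped one, and Fubini exchanges time and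
      expectation. In \<open>D = \<kappa> (1 + |Y|^2)\<close> the 1 contributes at most
      \<open>\<kappa> * T\<close> and the square contributes the integral of
      \<open>w\<close>.\<close>
    have m_w: "m t \<le> ennreal (\<kappa> * T) + ennreal \<kappa> * (\<integral>\<^sup>+s\<in>{0..t}. w s \<partial>lborel)" if t: "t \<in> {0..T}" for t
    proof -
      let ?G = "\<lambda>s \<omega>. indicator {\<omega>. R s \<omega> \<le> ennreal c} \<omega> :: ennreal"
      have "m t \<le> (\<integral>\<^sup>+\<omega>. \<integral>\<^sup>+s. ennreal (D \<omega> s) * ?G s \<omega> * indicator {0..t} s \<partial>lborel \<partial>M)"
        unfolding m_def
      proof (rule nn_integral_mono)
        fix \<omega> assume "\<omega> \<in> space M"
        from min_nn_integral_le_nn_integral_stopped[OF D_cont[OF this] D0 _ c, of t] t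
        show "min (ennreal c) (R t \<omega>) \<le> (\<integral>\<^sup>+s. ennreal (D \<omega> s) * ?G s \<omega> * indicator {0..t} s \<partial>lborel)"
          by (simp add: R_def indicator_def)
      qed
      also have "\<dots> = (\<integral>\<^sup>+s. \<integral>\<^sup>+\<omega>. ennreal (D \<omega> s) * ?G s \<omega> * indicator {0..t} s \<partial>M \<partial>lborel)"
        by (rule Fubini'[symmetric]) (simp add: split_beta' indicator_def, measurable)
      also have "\<dots> \<le> (\<integral>\<^sup>+s. ennreal \<kappa> * indicator {0..t} s + ennreal \<kappa> * (w s * indicator {0..t} s) \<partial>lborel)"
      proof (rule nn_integral_mono)
        fix s
        have "(\<integral>\<^sup>+\<omega>. ennreal (D \<omega> s) * ?G s \<omega> * indicator {0..t} s \<partial>M) \<le>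
          (\<integral>\<^sup>+\<omega>. ennreal \<kappa> * indicator {0..t} s + ennreal \<kappa> * (ennreal ((norm (Y \<omega> s))\<^sup>2) * ?G s \<omega>) * indicator {0..t} s \<partial>M)"
          using \<kappa> by (intro nn_integral_mono)
            (auto simp: D_def indicator_def ennreal_mult ennreal_plus distrib_left)
        also have "\<dots> = ennreal \<kappa> * indicator {0..t} s + ennreal \<kappa> * w s * indicator {0..t} s"
          by (simp add: nn_integral_add nn_integral_cmult nn_integral_multc emeasure_space_1 w_def)
        also have "\<dots> = ennreal \<kappa> * indicator {0..t} s + ennreal \<kappa> * (w s * indicator {0..t} s)"
          by (simp only: mult.assoc)
        finally show "(\<integral>\<^sup>+\<omega>. ennreal (D \<omega> s) * ?G s \<omega> * indicator {0..t} s \<partial>M) \<le>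
          ennreal \<kappa> * indicator {0..t} s + ennreal \<kappa> * (w s * indicator {0..t} s)" .
      qed
      also have "\<dots> = ennreal \<kappa> * ennreal t + ennreal \<kappa> * (\<integral>\<^sup>+s\<in>{0..t}. w s \<partial>lborel)"
      proof -
        \<comment> \<open>Splitting the time integral of the sum uses measurability of
          \<open>w\<close>, which comes from joint measurability of \<open>Y\<close> and
          \<open>R\<close>.\<close>
        have [measurable]: "w \<in> borel_measurable lborel"
        proof -
          have "(\<lambda>x. ennreal ((norm (case_prod Y x))\<^sup>2) * indicator {r. r \<le> ennreal c} (R (snd x) (fst x)))
              \<in> borel_measurable (M \<Otimes>\<^sub>M lborel)"
            by measurable
          from measurable_pair_swap[OF this]
          have "(\<lambda>(s, \<omega>). ennreal ((norm (Y \<omega> s))\<^sup>2) * ?G s \<omega>) \<in> borel_measurable (lborel \<Otimes>\<^sub>M M)"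
            by (simp add: split_beta' indicator_def)
          then show ?thesis unfolding w_def[abs_def]
            by (rule sigma_finite_measure.borel_measurable_nn_integral[OF prob_space_imp_sigma_finite[OF P]])
        qed
        show ?thesis using t by (simp add: nn_integral_add nn_integral_cmult nn_integral_cmult_indicator)
      qed
      also have "ennreal \<kappa> * ennreal t \<le> ennreal (\<kappa> * T)"
        using t \<kappa> by (simp add: mult_left_mono ennreal_leI flip: ennreal_mult)
      finally show ?thesis by (simp add: add_right_mono)
    qed
    show ?thesis
      unfolding w_def[symmetric]
    proof (rule gronwall_ennreal[where m="ennreal \<alpha> + ennreal \<beta> * ennreal c" and T=T])
      show "w t \<le> ennreal \<alpha> + ennreal \<beta> * ennreal c" if "t \<in> {0..T}" for t
        using w_le_m[OF that] m_c[of t] by (meson add_left_mono mult_left_mono order_trans zero_le)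
      show "w t \<le> ennreal (\<alpha> + \<beta> * \<kappa> * T) + ennreal (\<beta> * \<kappa>) * (\<integral>\<^sup>+s\<in>{0..t}. w s \<partial>lborel)" if "t \<in> {0..T}" for t
      proof -
        \<comment> \<open>Substituting \<open>m_w\<close> into \<open>w_le_m\<close> eliminates
          \<open>m\<close> and gives an inequality for \<open>w\<close> alone, with constants free
          of \<open>c\<close>.\<close>
        have "w t \<le> ennreal \<alpha> + ennreal \<beta> * (ennreal (\<kappa> * T) + ennreal \<kappa> * (\<integral>\<^sup>+s\<in>{0..t}. w s \<partial>lborel))"
          using w_le_m[OF that] m_w[OF that] by (meson add_left_mono mult_left_mono order_trans zero_le)
        also have "\<dots> = ennreal (\<alpha> + \<beta> * \<kappa> * T) + ennreal (\<beta> * \<kappa>) * (\<integral>\<^sup>+s\<in>{0..t}. w s \<partial>lborel)"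
          using \<alpha>\<beta> \<kappa> T by (simp add: ennreal_plus ennreal_mult distrib_left mult.assoc add.assoc)
        finally show ?thesis .
      qed
    qed (use \<alpha>\<beta> \<kappa> T in \<open>auto simp: ennreal_mult_less_top\<close>)
  qed
  \<comment> \<open>Continuous paths make \<open>D\<close> integrable over the compact horizon, so
    the events \<open>R T <= n\<close> increase to the whole space.\<close>
  have R_top: "R T \<omega> < \<top>" if "\<omega> \<in> space M" for \<omega>
  proof -
    have "set_integrable lborel {0..T} (D \<omega>)"
      by (rule borel_integrable_atLeastAtMost'[OF continuous_on_subset[OF D_cont[OF that]]]) simp
    then have "(\<integral>\<^sup>+s. ennreal (norm (indicator {0..T} s *\<^sub>R D \<omega> s)) \<partial>lborel) < \<top>"
      by (simp add: set_integrable_def integrable_iff_bounded)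
    also have "(\<integral>\<^sup>+s. ennreal (norm (indicator {0..T} s *\<^sub>R D \<omega> s)) \<partial>lborel) = R T \<omega>"
      unfolding R_def using D0 by (intro nn_integral_cong) (auto simp: indicator_def)
    finally show ?thesis .
  qed
  define U where "U n \<omega> = ennreal ((norm (Y \<omega> T))\<^sup>2) * indicator {\<omega>. R T \<omega> \<le> ennreal (real n)} \<omega>" for n \<omega>
  have "(\<integral>\<^sup>+\<omega>. ennreal ((norm (Y \<omega> T))\<^sup>2) \<partial>M) \<le> (\<integral>\<^sup>+\<omega>. (SUP n. U n \<omega>) \<partial>M)"
  proof (rule nn_integral_mono)
    fix \<omega> assume "\<omega> \<in> space M"
    from R_top[OF this] obtain c where "0 \<le> c" "R T \<omega> = ennreal c" by (cases "R T \<omega>") auto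
    moreover obtain n where "c \<le> real n" using real_arch_simple by blast
    ultimately have "ennreal ((norm (Y \<omega> T))\<^sup>2) = U n \<omega>" by (simp add: U_def ennreal_leI)
    then show "ennreal ((norm (Y \<omega> T))\<^sup>2) \<le> (SUP n. U n \<omega>)" by (metis SUP_upper UNIV_I)
  qed
  also have "\<dots> = (SUP n. \<integral>\<^sup>+\<omega>. U n \<omega> \<partial>M)"
  proof (rule nn_integral_monotone_convergence_SUP)
    have "R T \<omega> \<le> ennreal (real n')" if "n \<le> n'" "R T \<omega> \<le> ennreal (real n)" for n n' \<omega>
      using that(2) by (rule order_trans) (use that(1) in \<open>auto intro: ennreal_leI\<close>)
    then show "incseq U" unfolding incseq_def le_fun_def U_def by (auto simp: indicator_def)
    show "U n \<in> borel_measurable M" for n unfolding U_def[abs_def] by measurable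
  qed
  also have "\<dots> \<le> ennreal (2 * (\<alpha> + \<beta> * \<kappa> * T) * exp (2 * (\<beta> * \<kappa>) * T))"
    unfolding U_def by (intro SUP_least moment) simp
  also have "\<dots> < \<top>" by simp
  finally have Y2: "(\<integral>\<^sup>+\<omega>. ennreal ((norm (Y \<omega> T))\<^sup>2) \<partial>M) < \<top>" .
  have "(\<integral>\<^sup>+\<omega>. ennreal ((norm (X T \<omega>))\<^sup>2) \<partial>M) = (\<integral>\<^sup>+\<omega>. ennreal ((norm (Y \<omega> T))\<^sup>2) \<partial>M)"
  proof (rule nn_integral_cong_AE)
    show "AE \<omega> in M. ennreal ((norm (X T \<omega>))\<^sup>2) = ennreal ((norm (Y \<omega> T))\<^sup>2)"
      using Y_X by eventually_elim (use T in auto)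
  qed
  then show ?thesis using Y2 XM[of T] T by (auto simp: integrable_iff_bounded)
qed

section \<open>Extremal risk\<close>

text \<open>By Lipschitz continuity \<open>|g x|\<close> is at most \<open>|g 0| + L |x|\<close>,
  and constants are integrable on a probability space.\<close>

lemma (in prob_space) lipschitz_square_integrable:
  fixes g :: "'b::euclidean_space \<Rightarrow> real"
  assumes g: "L-lipschitz_on UNIV g" and \<xi>: "\<xi> \<in> borel_measurable M"
    and \<xi>2: "integrable M (\<lambda>\<omega>. (norm (\<xi> \<omega>))\<^sup>2)"
  shows "(\<lambda>\<omega>. g (\<xi> \<omega>)) \<in> square_integrable M"
proof -
  have gm: "(\<lambda>\<omega>. g (\<xi> \<omega>)) \<in> borel_measurable M"
    by (rule borel_measurable_continuous_on[OF lipschitz_on_continuous_on[OF g] \<xi>])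
  have "integrable M (\<lambda>\<omega>. (g (\<xi> \<omega>))\<^sup>2)"
  proof (rule Bochner_Integration.integrable_bound)
    show "integrable M (\<lambda>\<omega>. 3 * (g 0)\<^sup>2 + 3 * (L\<^sup>2 * (norm (\<xi> \<omega>))\<^sup>2))" using \<xi>2 by simp
    show "AE \<omega> in M. norm ((g (\<xi> \<omega>))\<^sup>2) \<le> norm (3 * (g 0)\<^sup>2 + 3 * (L\<^sup>2 * (norm (\<xi> \<omega>))\<^sup>2))"
    proof (rule AE_I2)
      fix \<omega>
      have "\<bar>g (\<xi> \<omega>) - g 0\<bar> \<le> L * norm (\<xi> \<omega>)"
        using lipschitz_onD[OF g, of "\<xi> \<omega>" 0] by (simp add: dist_norm)
      then have "\<bar>g (\<xi> \<omega>) - g 0\<bar>\<^sup>2 \<le> (L * norm (\<xi> \<omega>))\<^sup>2" by (intro power_mono) auto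
      \<comment> \<open>The three-term inequality with third term 0, hence the factors 3.\<close>
      with norm_add3_square_le[of "g 0" "g (\<xi> \<omega>) - g 0" 0]
      show "norm ((g (\<xi> \<omega>))\<^sup>2) \<le> norm (3 * (g 0)\<^sup>2 + 3 * (L\<^sup>2 * (norm (\<xi> \<omega>))\<^sup>2))"
        by (simp add: power_mult_distrib)
    qed
  qed (use gm in measurable)
  with gm show ?thesis by (simp add: square_integrable_def)
qed

theorem proposition1:
  fixes M :: "'a measure" and T K :: real and F :: "real \<Rightarrow> 'a measure"
    and W :: "real \<Rightarrow> 'a \<Rightarrow> real ^ 'd"
    and \<AA> :: "'k::euclidean_space set"
    and \<mu> :: "real ^ 'n \<Rightarrow> 'k \<Rightarrow> real ^ 'n"
    and \<sigma> :: "real ^ 'n \<Rightarrow> 'k \<Rightarrow> real ^ 'd ^ 'n"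
    and x0 :: "real ^ 'n"
    and X :: "(real \<Rightarrow> 'a \<Rightarrow> 'k) \<Rightarrow> real \<Rightarrow> 'a \<Rightarrow> real ^ 'n"
    and f :: "real \<times> (real ^ 'm) \<Rightarrow> real"
    and g :: "real ^ 'n \<Rightarrow> real"
    and \<rho> :: "('a \<Rightarrow> real) \<Rightarrow> real"
    and V :: "real ^ 'm \<Rightarrow> ereal"
  assumes "T > 0"
    and "prob_space M"
    and "usual_filtration M T F"
    and "brownian_motion M T F W"
    and "compact \<AA>"
    and "continuous_on (UNIV \<times> \<AA>) (\<lambda>(x, a). \<mu> x a)"
    and "continuous_on (UNIV \<times> \<AA>) (\<lambda>(x, a). \<sigma> x a)"
    and "K > 0"
    and "\<And>x x' a. a \<in> \<AA> \<Longrightarrow> norm (\<mu> x a - \<mu> x' a) + norm (\<sigma> x a - \<sigma> x' a) \<le> K * norm (x - x')"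
    and "\<And>x a. a \<in> \<AA> \<Longrightarrow> norm (\<mu> x a) + norm (\<sigma> x a) \<le> K * (1 + norm x + norm a)"
    and "\<And>A. A \<in> admissible_controls M T F \<AA> \<Longrightarrow> strong_solution M T F W \<mu> \<sigma> x0 A (X A)"
    and "convex_on UNIV f" and "at_most_quadratic_growth f"
    and "convex_on UNIV g" and "\<exists>L. L-lipschitz_on UNIV g"
    and "extremal_risk_measure M f \<rho>"
    and "\<And>y. V y = (INF A\<in>admissible_controls M T F \<AA>. ereal (\<integral>\<omega>. f (g (X A T \<omega>), y) \<partial>M))"
  shows "(INF A\<in>admissible_controls M T F \<AA>. ereal (\<rho> (\<lambda>\<omega>. g (X A T \<omega>)))) = (INF y. V y)"
proof -
  interpret prob_space M by fact
  obtain L where L: "L-lipschitz_on UNIV g" using assms(15) by blast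
  \<comment> \<open>Boundedness of the control set absorbs \<open>norm a\<close> into the growth
    constant \<open>?k\<close>, uniformly over all controls.\<close>
  obtain B where B: "0 < B" "\<And>a. a \<in> \<AA> \<Longrightarrow> norm a \<le> B"
    using compact_imp_bounded[OF \<open>compact \<AA>\<close>] unfolding bounded_pos by blast
  let ?k = "K * (1 + B)"
  have k: "0 < ?k" using \<open>K > 0\<close> B by simp
  have growth: "norm (\<mu> x a) \<le> ?k * (1 + norm x) \<and> norm (\<sigma> x a) \<le> ?k * (1 + norm x)" if a: "a \<in> \<AA>" for x a
  proof -
    have "1 + norm x + norm a \<le> 1 + norm x + B" using B(2)[OF a] by simp
    also have "\<dots> \<le> (1 + B) * (1 + norm x)" using B(1) by (simp add: algebra_simps)
    finally have "K * (1 + norm x + norm a) \<le> ?k * (1 + norm x)"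
      using \<open>K > 0\<close> by simp
    with assms(10)[OF a, of x] norm_ge_zero[of "\<mu> x a"] norm_ge_zero[of "\<sigma> x a"] show ?thesis by linarith
  qed
  \<comment> \<open>\<open>\<rho>\<close> is tied to \<open>f\<close> only on square integrable
    functions; this is where the second moment of \<open>X A T\<close> enters.\<close>
  have "ereal (\<rho> (\<lambda>\<omega>. g (X A T \<omega>))) = (INF y. ereal (\<integral>\<omega>. f (g (X A T \<omega>), y) \<partial>M))"
    if A: "A \<in> admissible_controls M T F \<AA>" for A
  proof -
    note X = assms(11)[OF A]
    have "subalgebra M (F T)" using assms(1,3) by (auto simp: usual_filtration_def)
    moreover have "X A T \<in> borel_measurable (F T)"
      using X assms(1) by (auto simp: strong_solution_def adapted_def)
    ultimately have "X A T \<in> borel_measurable M" by (rule measurable_from_subalg)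
    moreover have "integrable M (\<lambda>\<omega>. (norm (X A T \<omega>))\<^sup>2)"
      by (rule strong_solution_second_moment[OF assms(2,3,4,1) k growth A X])
    ultimately have "(\<lambda>\<omega>. g (X A T \<omega>)) \<in> square_integrable M"
      by (rule lipschitz_square_integrable[OF L])
    then show ?thesis using \<open>extremal_risk_measure M f \<rho>\<close> by (simp add: extremal_risk_measure_def)
  qed
  then have "(INF A\<in>admissible_controls M T F \<AA>. ereal (\<rho> (\<lambda>\<omega>. g (X A T \<omega>)))) =
      (INF A\<in>admissible_controls M T F \<AA>. INF y. ereal (\<integral>\<omega>. f (g (X A T \<omega>), y) \<partial>M))"
    by (intro INF_cong) auto
  \<comment> \<open>Both infima are taken in the complete lattice of extended reals, so they commute
    whatever the index sets.\<close>
  also have "\<dots> = (INF y. V y)"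
    unfolding assms(17) by (rule INF_commute)
  finally show ?thesis .
qed

end
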